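(* Let $L$ be a finite-dimensional Lie algebra over any field $F$. Then $\mathrm{Sec}(M)$ is nil for every maximal subalgebra $M$ of $L$ if and only if $L$ is solvable.
   Context: A chief factor of $L$ is a quotient $C/D$ where $D \subsetneq C$ are ideals of $L$ and $C/D$ is a minimal ideal of $L/D$. Let $M$ be a maximal subalgebra of $L$. If $C/D$ is a chief factor of $L$ with $D \subseteq M$ and $L = M + C$, then $(M\cap C)/D$ is called a c-section of $M$ in $L$. All c-sections of $M$ are isomorphic; $\mathrm{Sec}(M)$ denotes the Lie algebra isomorphic to any c-section of $M$. A subalgebra $U$ of a Lie algebra $L$ is nil if $\mathrm{ad}\,u$ acts nilpotently on $L$ for all $u \in U$. "$\mathrm{Sec}(M)$ is nil" means that a c-section $(M\cap C)/D$ is nil as a subalgebra of $L/D$, i.e. $\mathrm{ad}(x+D)$ acts nilpotently on $L/D$ for every $x \in M \cap C$ (this does not depend on the choice of the chief factor $C/D$). *)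

theory Defs
  imports "Jordan_Normal_Form.Missing_VectorSpace" "HOL-Algebra.AbelCoset"
begin

record ('a, 'b) lie = "('a, 'b) module" +
  lbr :: "'b \<Rightarrow> 'b \<Rightarrow> 'b"

locale lie_algebra = vectorspace F L
  for F :: "('a, 'n) ring_scheme" and L :: "('a, 'b, 'm) lie_scheme" +
  assumes lbr_closed: "\<lbrakk>x \<in> carrier L; y \<in> carrier L\<rbrakk> \<Longrightarrow> lbr L x y \<in> carrier L"
    and lbr_add_left: "\<lbrakk>x \<in> carrier L; y \<in> carrier L; z \<in> carrier L\<rbrakk> \<Longrightarrow>
      lbr L (x \<oplus>\<^bsub>L\<^esub> y) z = lbr L x z \<oplus>\<^bsub>L\<^esub> lbr L y z"
    and lbr_add_right: "\<lbrakk>x \<in> carrier L; y \<in> carrier L; z \<in> carrier L\<rbrakk> \<Longrightarrow>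
      lbr L x (y \<oplus>\<^bsub>L\<^esub> z) = lbr L x y \<oplus>\<^bsub>L\<^esub> lbr L x z"
    and lbr_smult_left: "\<lbrakk>a \<in> carrier F; x \<in> carrier L; y \<in> carrier L\<rbrakk> \<Longrightarrow>
      lbr L (a \<odot>\<^bsub>L\<^esub> x) y = a \<odot>\<^bsub>L\<^esub> lbr L x y"
    and lbr_smult_right: "\<lbrakk>a \<in> carrier F; x \<in> carrier L; y \<in> carrier L\<rbrakk> \<Longrightarrow>
      lbr L x (a \<odot>\<^bsub>L\<^esub> y) = a \<odot>\<^bsub>L\<^esub> lbr L x y"
    and lbr_alternating: "x \<in> carrier L \<Longrightarrow> lbr L x x = \<zero>\<^bsub>L\<^esub>"
    and jacobi: "\<lbrakk>x \<in> carrier L; y \<in> carrier L; z \<in> carrier L\<rbrakk> \<Longrightarrow>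
      lbr L x (lbr L y z) \<oplus>\<^bsub>L\<^esub> lbr L y (lbr L z x) \<oplus>\<^bsub>L\<^esub> lbr L z (lbr L x y) = \<zero>\<^bsub>L\<^esub>"

definition lie_subalgebra ::
  "('a, 'n) ring_scheme \<Rightarrow> ('a, 'b, 'm) lie_scheme \<Rightarrow> 'b set \<Rightarrow> bool" where
  "lie_subalgebra F L U \<longleftrightarrow>
     VectorSpace.subspace F U L \<and> (\<forall>x\<in>U. \<forall>y\<in>U. lbr L x y \<in> U)"

definition lie_ideal ::
  "('a, 'n) ring_scheme \<Rightarrow> ('a, 'b, 'm) lie_scheme \<Rightarrow> 'b set \<Rightarrow> bool" where
  "lie_ideal F L I \<longleftrightarrow>
     VectorSpace.subspace F I L \<and> (\<forall>x\<in>carrier L. \<forall>y\<in>I. lbr L x y \<in> I)"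

definition maximal_subalgebra ::
  "('a, 'n) ring_scheme \<Rightarrow> ('a, 'b, 'm) lie_scheme \<Rightarrow> 'b set \<Rightarrow> bool" where
  "maximal_subalgebra F L M \<longleftrightarrow>
     maximal M (\<lambda>U. lie_subalgebra F L U \<and> U \<noteq> carrier L)"

definition minimal_ideal ::
  "('a, 'n) ring_scheme \<Rightarrow> ('a, 'b, 'm) lie_scheme \<Rightarrow> 'b set \<Rightarrow> bool" where
  "minimal_ideal F L I \<longleftrightarrow>
     minimal I (\<lambda>J. lie_ideal F L J \<and> J \<noteq> {\<zero>\<^bsub>L\<^esub>})"

text \<open>
  The quotient algebra \<open>L/D\<close> of cosets of \<open>D\<close>; each union below is a single coset
  when \<open>D\<close> is an ideal. The record type \<open>module\<close> inherits the fields \<open>mult\<close> and \<open>one\<close>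
  from \<open>ring\<close>; no notion used here depends on them and their values here are arbitrary.
\<close>

definition lie_quotient :: "('a, 'b, 'm) lie_scheme \<Rightarrow> 'b set \<Rightarrow> ('a, 'b set) lie" where
  "lie_quotient L D =
     \<lparr>carrier = a_rcosets\<^bsub>L\<^esub> D, mult = (\<lambda>X Y. D), one = D,
      zero = D, add = (\<lambda>X Y. X <+>\<^bsub>L\<^esub> Y),
      smult = (\<lambda>a X. \<Union>x\<in>X. D +>\<^bsub>L\<^esub> (a \<odot>\<^bsub>L\<^esub> x)),
      lbr = (\<lambda>X Y. \<Union>x\<in>X. \<Union>y\<in>Y. D +>\<^bsub>L\<^esub> lbr L x y)\<rparr>"

text \<open>The image \<open>(S + D)/D\<close> of \<open>S\<close> in \<open>L/D\<close>, that is \<open>S/D\<close> when \<open>D \<subseteq> S\<close>.\<close>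

definition quotient_image ::
  "('a, 'b, 'm) lie_scheme \<Rightarrow> 'b set \<Rightarrow> 'b set \<Rightarrow> 'b set set" where
  "quotient_image L D S = (\<lambda>x. D +>\<^bsub>L\<^esub> x) ` S"

definition chief_factor ::
  "('a, 'n) ring_scheme \<Rightarrow> ('a, 'b, 'm) lie_scheme \<Rightarrow> 'b set \<Rightarrow> 'b set \<Rightarrow> bool" where
  "chief_factor F L C D \<longleftrightarrow>
     lie_ideal F L D \<and> lie_ideal F L C \<and> D \<subset> C \<and>
     minimal_ideal F (lie_quotient L D) (quotient_image L D C)"

text \<open>The pair \<open>C\<close>, \<open>D\<close> gives rise to the c-section \<open>(M \<inter> C)/D\<close> of \<open>M\<close>.\<close>

definition gives_c_section ::
  "('a, 'n) ring_scheme \<Rightarrow> ('a, 'b, 'm) lie_scheme \<Rightarrow> 'b set \<Rightarrow> 'b set \<Rightarrow> 'b set \<Rightarrow> bool" where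
  "gives_c_section F L M C D \<longleftrightarrow>
     chief_factor F L C D \<and> D \<subseteq> M \<and> carrier L = M <+>\<^bsub>L\<^esub> C"

definition nil_subalgebra ::
  "('a, 'n) ring_scheme \<Rightarrow> ('a, 'b, 'm) lie_scheme \<Rightarrow> 'b set \<Rightarrow> bool" where
  "nil_subalgebra F L U \<longleftrightarrow> lie_subalgebra F L U \<and>
     (\<forall>u\<in>U. \<exists>n. \<forall>x\<in>carrier L. (lbr L u ^^ n) x = \<zero>\<^bsub>L\<^esub>)"

text \<open>
  Being nil refers to the action on \<open>L/D\<close>, so it is stated for a c-section rather than for
  the isomorphism class \<open>Sec(M)\<close>. It does not depend on the choice of the chief factor.
\<close>

definition Sec_nil ::
  "('a, 'n) ring_scheme \<Rightarrow> ('a, 'b, 'm) lie_scheme \<Rightarrow> 'b set \<Rightarrow> bool" where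
  "Sec_nil F L M \<longleftrightarrow>
     (\<exists>C D. gives_c_section F L M C D \<and>
        nil_subalgebra F (lie_quotient L D) (quotient_image L D (M \<inter> C)))"

definition lie_derived ::
  "('a, 'n) ring_scheme \<Rightarrow> ('a, 'b, 'm) lie_scheme \<Rightarrow> 'b set \<Rightarrow> 'b set" where
  "lie_derived F L U = LinearCombinations.module.span F L {lbr L x y | x y. x \<in> U \<and> y \<in> U}"

definition lie_solvable ::
  "('a, 'n) ring_scheme \<Rightarrow> ('a, 'b, 'm) lie_scheme \<Rightarrow> bool" where
  "lie_solvable F L \<longleftrightarrow> (\<exists>n. (lie_derived F L ^^ n) (carrier L) = {\<zero>\<^bsub>L\<^esub>})"

end

(*
Suppose Sec(M) is nil for all maximal M but L is not solvable. The stable term P of the derived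
series is a nonzero perfect ideal; let A be an ideal maximal among those not containing P, so that
P lies in every ideal strictly above A, and put B = A + P. If some x in B were not ad-nilpotent
modulo A, its Fitting null component in L/A would be proper, hence contained in a maximal subalgebra
M, and M + B = L by Fitting's lemma. For a c-section (M \<inter> C)/D of M this forces D \<subseteq> A and
P \<subseteq> C + A, so x differs from an element of M \<inter> C by an element of A and is ad-nilpotent modulo A
after all. So B/A consists of ad-nilpotent elements, and Engel's theorem contradicts B = [B,B] + A.

Conversely, in a solvable L chief factors C/D are abelian, so (ad x)^2 maps L into D for x in C.
*)
theory Submission
  imports Defs
begin

section \<open>Subspaces\<close>

context vectorspace
begin

lemma subspace_iff:
  "subspace K W V \<longleftrightarrow> W \<subseteq> carrier V \<and> \<zero>\<^bsub>V\<^esub> \<in> W \<and> (\<forall>x\<in>W. \<forall>y\<in>W. x \<oplus>\<^bsub>V\<^esub> y \<in> W) \<and>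
     (\<forall>a\<in>carrier K. \<forall>x\<in>W. a \<odot>\<^bsub>V\<^esub> x \<in> W)"
  unfolding subspace_def submodule_def
  using vectorspace_axioms module_axioms by blast

lemma subspace_subset: "subspace K W V \<Longrightarrow> W \<subseteq> carrier V"
  and subspace_zero: "subspace K W V \<Longrightarrow> \<zero>\<^bsub>V\<^esub> \<in> W"
  and subspace_add: "\<lbrakk>subspace K W V; x \<in> W; y \<in> W\<rbrakk> \<Longrightarrow> x \<oplus>\<^bsub>V\<^esub> y \<in> W"
  and subspace_smult: "\<lbrakk>subspace K W V; a \<in> carrier K; x \<in> W\<rbrakk> \<Longrightarrow> a \<odot>\<^bsub>V\<^esub> x \<in> W"
  by (auto simp: subspace_iff)

lemma subspace_neg:
  assumes "subspace K W V" "x \<in> W"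
  shows "\<ominus>\<^bsub>V\<^esub> x \<in> W"
proof -
  have x: "x \<in> carrier V" using assms subspace_subset by blast
  have "\<ominus>\<^bsub>V\<^esub> x = (\<ominus>\<^bsub>K\<^esub> \<one>\<^bsub>K\<^esub>) \<odot>\<^bsub>V\<^esub> x" using x by (simp add: smult_l_minus)
  thus ?thesis using subspace_smult[OF assms(1) _ assms(2)] by simp
qed

lemma subspace_add_cancel_left:
  assumes "subspace K W V" "x \<in> W" "y \<in> carrier V" "x \<oplus>\<^bsub>V\<^esub> y \<in> W"
  shows "y \<in> W"
proof -
  have x: "x \<in> carrier V" using assms subspace_subset by blast
  have "\<ominus>\<^bsub>V\<^esub> x \<oplus>\<^bsub>V\<^esub> (x \<oplus>\<^bsub>V\<^esub> y) \<in> W"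
    using subspace_add[OF assms(1) subspace_neg[OF assms(1,2)] assms(4)] .
  thus ?thesis using M.r_neg1[OF x assms(3)] by simp
qed

lemma subspace_zero_set: "subspace K {\<zero>\<^bsub>V\<^esub>} V"
  by (simp add: subspace_iff)

lemma subspace_carrier: "subspace K (carrier V) V"
  by (simp add: subspace_iff)

lemma subspace_Int:
  "\<lbrakk>subspace K U V; subspace K W V\<rbrakk> \<Longrightarrow> subspace K (U \<inter> W) V"
  by (auto simp: subspace_iff)

text \<open>Bridges the sum of sets in which c-sections are stated and the sum of submodules for
  which the linear algebra library has its facts.\<close>

lemma set_add_eq_subspace_sum: "U <+>\<^bsub>V\<^esub> W = subspace_sum U W"
  by (auto simp: set_add_def' submodule_sum_def)

lemma subspace_set_add:
  "\<lbrakk>subspace K U V; subspace K W V\<rbrakk> \<Longrightarrow> subspace K (U <+>\<^bsub>V\<^esub> W) V"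
  unfolding set_add_eq_subspace_sum by (rule sum_is_subspace)

lemma set_add_upper_left: "\<lbrakk>subspace K U V; subspace K W V\<rbrakk> \<Longrightarrow> U \<subseteq> U <+>\<^bsub>V\<^esub> W"
  unfolding set_add_eq_subspace_sum by (rule in_sum_vs)

lemma set_add_upper_right: "\<lbrakk>subspace K U V; subspace K W V\<rbrakk> \<Longrightarrow> W \<subseteq> U <+>\<^bsub>V\<^esub> W"
  unfolding set_add_eq_subspace_sum by (subst vsum_comm) (auto intro: in_sum_vs[THEN subsetD])

lemma set_add_least:
  "\<lbrakk>subspace K X V; U \<subseteq> X; W \<subseteq> X\<rbrakk> \<Longrightarrow> U <+>\<^bsub>V\<^esub> W \<subseteq> X"
  by (auto simp: set_add_def' intro!: subspace_add)

lemma set_addE: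
  assumes "z \<in> U <+>\<^bsub>V\<^esub> W"
  obtains x y where "x \<in> U" "y \<in> W" "z = x \<oplus>\<^bsub>V\<^esub> y"
  using assms by (auto simp: set_add_def')

section \<open>Rank of subsets and extremal subspaces\<close>

text \<open>In finite dimension, the rank of a subspace is its dimension. Counting independent sets
  inside \<open>V\<close> spares treating each subspace as a vector space of its own.\<close>

definition subset_rank :: "'c set \<Rightarrow> nat" where
  "subset_rank W = Max (card ` {S. S \<subseteq> W \<and> lin_indpt S})"

lemma finite_card_lin_indpt:
  assumes "fin_dim" "W \<subseteq> carrier V"
  shows "finite (card ` {S. S \<subseteq> W \<and> lin_indpt S})"
proof (rule finite_subset)
  show "card ` {S. S \<subseteq> W \<and> lin_indpt S} \<subseteq> {..dim}"
    using li_le_dim(2)[OF assms(1)] assms(2) by blast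
qed simp

lemma card_le_subset_rank:
  "\<lbrakk>fin_dim; W \<subseteq> carrier V; S \<subseteq> W; lin_indpt S\<rbrakk> \<Longrightarrow> card S \<le> subset_rank W"
  unfolding subset_rank_def by (intro Max_ge finite_card_lin_indpt) auto

lemma subset_rank_attained:
  assumes "fin_dim" "W \<subseteq> carrier V"
  obtains S where "S \<subseteq> W" "lin_indpt S" "card S = subset_rank W"
proof -
  have "lin_indpt {}" by (auto simp: lin_dep_def)
  hence "card ` {S. S \<subseteq> W \<and> lin_indpt S} \<noteq> {}" by blast
  from Max_in[OF finite_card_lin_indpt[OF assms] this] that show ?thesis
    unfolding subset_rank_def by auto
qed

lemma subset_rank_le_dim: "\<lbrakk>fin_dim; W \<subseteq> carrier V\<rbrakk> \<Longrightarrow> subset_rank W \<le> dim"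
  by (metis subset_rank_attained li_le_dim(2) subset_trans)

text \<open>A largest independent subset of \<open>W\<close> has its span inside \<open>W\<close>,
  so it stays independent after adding a vector of \<open>U\<close> outside
  \<open>W\<close>.\<close>

lemma subset_rank_strict_mono:
  assumes fd: "fin_dim" and W: "subspace K W V" and WU: "W \<subset> U" and U: "U \<subseteq> carrier V"
  shows "subset_rank W < subset_rank U"
proof -
  obtain S where S: "S \<subseteq> W" "lin_indpt S" "card S = subset_rank W"
    using subset_rank_attained[OF fd] subspace_subset[OF W] by blast
  obtain v where v: "v \<in> U" "v \<notin> W" using WU by blast
  have SV: "S \<subseteq> carrier V" using S WU U by blast
  have "span S \<subseteq> W" using S W by (intro span_is_subset) auto
  hence "lin_indpt (S \<union> {v})"
    using lin_dep_iff_in_span[OF SV S(2), of v] v S U by blast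
  hence "card (S \<union> {v}) \<le> subset_rank U"
    using S v WU by (intro card_le_subset_rank[OF fd U]) auto
  moreover have "card (S \<union> {v}) = Suc (card S)"
    using v S li_le_dim(1)[OF fd SV S(2)] by (auto simp: card_insert_if)
  ultimately show ?thesis using S by simp
qed

text \<open>Among the sets above \<open>W\<close> with property \<open>P\<close>, one of largest
  rank is maximal: a strictly larger one would have larger rank.\<close>

lemma maximal_subspace_exists:
  assumes fd: "fin_dim" and "P W" and P: "\<And>U. P U \<Longrightarrow> subspace K U V"
  obtains U where "W \<subseteq> U" "maximal U P"
proof -
  let ?Q = "\<lambda>U. P U \<and> W \<subseteq> U"
  have "\<forall>U. ?Q U \<longrightarrow> subset_rank U < Suc dim"
    using subset_rank_le_dim[OF fd] subspace_subset P by (auto simp: less_Suc_eq_le)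
  then obtain U where U: "?Q U" "\<And>X. ?Q X \<Longrightarrow> subset_rank X \<le> subset_rank U"
    using ex_has_greatest_nat[of ?Q W subset_rank "Suc dim"] assms(2) by auto
  have "X = U" if X: "U \<subseteq> X" "P X" for X
  proof (rule ccontr)
    assume "X \<noteq> U"
    hence "subset_rank U < subset_rank X"
      using X U subspace_subset[OF P[OF X(2)]] P by (intro subset_rank_strict_mono[OF fd]) auto
    thus False using U(2)[of X] U(1) X by auto
  qed
  thus thesis using U that[of U] by (auto simp: maximal_def)
qed

text \<open>Least rank gives minimality. Here \<open>W\<close> only witnesses that \<open>P\<close>
  can be satisfied; the set found need not lie inside it.\<close>

lemma minimal_subspace_exists:
  assumes fd: "fin_dim" and "P W" and P: "\<And>U. P U \<Longrightarrow> subspace K U V"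
  obtains U where "minimal U P"
proof -
  obtain U where U: "P U" "\<And>X. P X \<Longrightarrow> subset_rank U \<le> subset_rank X"
    using ex_has_least_nat[of P W subset_rank] assms(2) by blast
  have "X = U" if X: "X \<subseteq> U" "P X" for X
  proof (rule ccontr)
    assume "X \<noteq> U"
    hence "subset_rank X < subset_rank U"
      using X U subspace_subset[OF P[OF U(1)]] P by (intro subset_rank_strict_mono[OF fd]) auto
    thus False using U(2)[of X] X by auto
  qed
  thus thesis using U that[of U] by (auto simp: minimal_def)
qed

text \<open>A minimal member \<open>T n\<close> of the range contains all later terms, hence equals
  them.\<close>

lemma decreasing_subspaces_stabilise:
  assumes fd: "fin_dim" and T: "\<And>n. subspace K (T n) V" and dec: "\<And>n. T (Suc n) \<subseteq> T n"
  shows "\<exists>n. \<forall>m\<ge>n. T m = T n"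
proof -
  obtain U where U: "minimal U (\<lambda>U. U \<in> range T)"
    using minimal_subspace_exists[OF fd, of "\<lambda>U. U \<in> range T" "T 0"] T by blast
  then obtain n where n: "U = T n" by (auto simp: minimal_def)
  have "T m \<subseteq> T n" if "n \<le> m" for m
    using lift_Suc_antimono_le[of T, OF dec that] .
  hence "T m = T n" if "n \<le> m" for m
    using U n that unfolding minimal_def by blast
  thus ?thesis by blast
qed

end

section \<open>Fitting decomposition\<close>

context lie_algebra
begin

section \<open>Bracket identities, subalgebras and ideals\<close>

lemma lbr_zero_left: "x \<in> carrier L \<Longrightarrow> lbr L \<zero>\<^bsub>L\<^esub> x = \<zero>\<^bsub>L\<^esub>"
  using lbr_smult_left[of "\<zero>\<^bsub>F\<^esub>" x x] lbr_closed by simp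

lemma lbr_zero_right: "x \<in> carrier L \<Longrightarrow> lbr L x \<zero>\<^bsub>L\<^esub> = \<zero>\<^bsub>L\<^esub>"
  using lbr_smult_right[of "\<zero>\<^bsub>F\<^esub>" x x] lbr_closed by simp

lemma lbr_minus_right:
  assumes "x \<in> carrier L" "y \<in> carrier L"
  shows "lbr L x (\<ominus>\<^bsub>L\<^esub> y) = \<ominus>\<^bsub>L\<^esub> lbr L x y"
  using lbr_smult_right[of "\<ominus>\<^bsub>F\<^esub> \<one>\<^bsub>F\<^esub>" x y] lbr_closed assms by (simp add: smult_l_minus)

lemma lbr_skew:
  assumes x: "x \<in> carrier L" and y: "y \<in> carrier L"
  shows "lbr L y x = \<ominus>\<^bsub>L\<^esub> lbr L x y"
proof -
  have "lbr L (x \<oplus>\<^bsub>L\<^esub> y) (x \<oplus>\<^bsub>L\<^esub> y) = lbr L y x \<oplus>\<^bsub>L\<^esub> lbr L x y"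
    using x y by (simp add: lbr_add_left lbr_add_right lbr_closed lbr_alternating[OF x] lbr_alternating[OF y])
  hence "lbr L y x \<oplus>\<^bsub>L\<^esub> lbr L x y = \<zero>\<^bsub>L\<^esub>"
    using x y lbr_alternating[of "x \<oplus>\<^bsub>L\<^esub> y"] by simp
  thus ?thesis using M.minus_equality x y lbr_closed by metis
qed

text \<open>This is the Jacobi identity read as saying that \<open>ad x\<close> is a derivation; two
  of its terms change sign by skew-symmetry.\<close>

lemma lbr_leibniz:
  assumes x: "x \<in> carrier L" and y: "y \<in> carrier L" and z: "z \<in> carrier L"
  shows "lbr L x (lbr L y z) = lbr L (lbr L x y) z \<oplus>\<^bsub>L\<^esub> lbr L y (lbr L x z)"
proof -
  note cl = lbr_closed x y z M.a_closed M.a_inv_closed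
  have 1: "lbr L y (lbr L z x) = \<ominus>\<^bsub>L\<^esub> lbr L y (lbr L x z)"
    using lbr_skew[OF x z] lbr_minus_right cl by simp
  have 2: "lbr L z (lbr L x y) = \<ominus>\<^bsub>L\<^esub> lbr L (lbr L x y) z"
    using lbr_skew[of "lbr L x y" z] cl by simp
  let ?a = "lbr L x (lbr L y z)" and ?b = "lbr L y (lbr L x z)" and ?c = "lbr L (lbr L x y) z"
  have "?a \<oplus>\<^bsub>L\<^esub> (\<ominus>\<^bsub>L\<^esub> (?c \<oplus>\<^bsub>L\<^esub> ?b)) = \<zero>\<^bsub>L\<^esub>"
    using jacobi[OF x y z] 1 2 cl by (simp add: M.minus_add M.a_ac)
  thus ?thesis using M.minus_equality[of ?a "\<ominus>\<^bsub>L\<^esub> (?c \<oplus>\<^bsub>L\<^esub> ?b)"] cl by simp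
qed

lemma subalgebra_subspace: "lie_subalgebra F L U \<Longrightarrow> subspace F U L"
  and subalgebra_lbr: "\<lbrakk>lie_subalgebra F L U; x \<in> U; y \<in> U\<rbrakk> \<Longrightarrow> lbr L x y \<in> U"
  by (auto simp: lie_subalgebra_def)

lemma ideal_subspace: "lie_ideal F L I \<Longrightarrow> subspace F I L"
  and ideal_lbr_right: "\<lbrakk>lie_ideal F L I; x \<in> carrier L; y \<in> I\<rbrakk> \<Longrightarrow> lbr L x y \<in> I"
  by (auto simp: lie_ideal_def)

lemma ideal_subset: "lie_ideal F L I \<Longrightarrow> I \<subseteq> carrier L"
  using subspace_subset ideal_subspace by blast

lemma ideal_lbr_left:
  assumes "lie_ideal F L I" "x \<in> I" "y \<in> carrier L"
  shows "lbr L x y \<in> I"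
proof -
  have "x \<in> carrier L" using assms ideal_subset by blast
  thus ?thesis
    using lbr_skew[of y x] subspace_neg[OF ideal_subspace ideal_lbr_right] assms by metis
qed

lemma ideal_subalgebra: "lie_ideal F L I \<Longrightarrow> lie_subalgebra F L I"
  using ideal_subset by (auto simp: lie_ideal_def lie_subalgebra_def)

lemma ideal_zero: "lie_ideal F L {\<zero>\<^bsub>L\<^esub>}"
  by (simp add: lie_ideal_def subspace_zero_set lbr_zero_right)

lemma ideal_carrier: "lie_ideal F L (carrier L)"
  by (simp add: lie_ideal_def subspace_carrier lbr_closed)

lemma ideal_Int: "\<lbrakk>lie_ideal F L I; lie_ideal F L J\<rbrakk> \<Longrightarrow> lie_ideal F L (I \<inter> J)"
  by (simp add: lie_ideal_def subspace_Int)

lemma subalgebra_set_add: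
  assumes U: "lie_subalgebra F L U" and I: "lie_ideal F L I"
  shows "lie_subalgebra F L (U <+>\<^bsub>L\<^esub> I)"
proof -
  have sub: "subspace F U L" "subspace F I L" using U I subalgebra_subspace ideal_subspace by auto
  note sum = subspace_set_add[OF sub]
  have "lbr L x y \<in> U <+>\<^bsub>L\<^esub> I" if "x \<in> U <+>\<^bsub>L\<^esub> I" "y \<in> U <+>\<^bsub>L\<^esub> I" for x y
  proof -
    from that obtain u i v j where u: "u \<in> U" and i: "i \<in> I" and v: "v \<in> U" and j: "j \<in> I"
      and xy: "x = u \<oplus>\<^bsub>L\<^esub> i" "y = v \<oplus>\<^bsub>L\<^esub> j" by (elim set_addE)
    have c: "u \<in> carrier L" "i \<in> carrier L" "v \<in> carrier L" "j \<in> carrier L"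
      using sub[THEN subspace_subset] u i v j by auto
    have "lbr L x y = lbr L u v \<oplus>\<^bsub>L\<^esub> (lbr L u j \<oplus>\<^bsub>L\<^esub> (lbr L i v \<oplus>\<^bsub>L\<^esub> lbr L i j))"
      using c xy by (simp add: lbr_add_left lbr_add_right lbr_closed M.a_ac)
    moreover have "lbr L u v \<in> U" using U u v by (rule subalgebra_lbr)
    moreover have "lbr L u j \<oplus>\<^bsub>L\<^esub> (lbr L i v \<oplus>\<^bsub>L\<^esub> lbr L i j) \<in> I"
      using I i j c by (intro subspace_add[OF sub(2)] ideal_lbr_left ideal_lbr_right) auto
    ultimately show ?thesis
      using set_add_upper_left[OF sub] set_add_upper_right[OF sub] subspace_add[OF sum] by auto
  qed
  thus ?thesis using sum by (simp add: lie_subalgebra_def)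
qed

lemma ideal_set_add:
  assumes I: "lie_ideal F L I" and J: "lie_ideal F L J"
  shows "lie_ideal F L (I <+>\<^bsub>L\<^esub> J)"
proof -
  have sub: "subspace F I L" "subspace F J L" using I J ideal_subspace by auto
  note sum = subspace_set_add[OF sub]
  have "lbr L x z \<in> I <+>\<^bsub>L\<^esub> J" if x: "x \<in> carrier L" and z: "z \<in> I <+>\<^bsub>L\<^esub> J" for x z
  proof -
    from z obtain i j where ij: "i \<in> I" "j \<in> J" "z = i \<oplus>\<^bsub>L\<^esub> j" by (elim set_addE)
    moreover have "i \<in> carrier L" "j \<in> carrier L" using sub[THEN subspace_subset] ij by auto
    ultimately have "lbr L x z = lbr L x i \<oplus>\<^bsub>L\<^esub> lbr L x j" using x by (simp add: lbr_add_right)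
    moreover have "lbr L x i \<in> I" "lbr L x j \<in> J" using ij x I J ideal_lbr_right by auto
    ultimately show ?thesis
      using set_add_upper_left[OF sub] set_add_upper_right[OF sub] subspace_add[OF sum] by auto
  qed
  thus ?thesis using sum by (simp add: lie_ideal_def)
qed

section \<open>Powers of ad x and the Fitting null component\<close>

lemma ad_pow_closed: "\<lbrakk>x \<in> carrier L; y \<in> carrier L\<rbrakk> \<Longrightarrow> (lbr L x ^^ n) y \<in> carrier L"
  by (induction n) (auto simp: lbr_closed)

lemma ad_pow_add:
  "\<lbrakk>x \<in> carrier L; y \<in> carrier L; z \<in> carrier L\<rbrakk> \<Longrightarrow>
    (lbr L x ^^ n) (y \<oplus>\<^bsub>L\<^esub> z) = (lbr L x ^^ n) y \<oplus>\<^bsub>L\<^esub> (lbr L x ^^ n) z"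
  by (induction n) (auto simp: lbr_add_right ad_pow_closed)

lemma ad_pow_smult:
  "\<lbrakk>x \<in> carrier L; y \<in> carrier L; a \<in> carrier F\<rbrakk> \<Longrightarrow>
    (lbr L x ^^ n) (a \<odot>\<^bsub>L\<^esub> y) = a \<odot>\<^bsub>L\<^esub> (lbr L x ^^ n) y"
  by (induction n) (auto simp: lbr_smult_right ad_pow_closed)

lemma ad_pow_invariant:
  "\<lbrakk>\<And>y. y \<in> W \<Longrightarrow> lbr L x y \<in> W; y \<in> W\<rbrakk> \<Longrightarrow> (lbr L x ^^ n) y \<in> W"
  by (induction n) auto

lemma ad_pow_mono:
  assumes "lie_ideal F L A" "x \<in> carrier L" "(lbr L x ^^ m) y \<in> A" "m \<le> n"
  shows "(lbr L x ^^ n) y \<in> A"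
proof -
  have "(lbr L x ^^ (n - m)) ((lbr L x ^^ m) y) \<in> A"
    using ad_pow_invariant[OF ideal_lbr_right[OF assms(1,2)] assms(3)] .
  thus ?thesis using funpow_add[of "n - m" m "lbr L x"] assms(4) by simp
qed

text \<open>For an ideal \<open>A\<close>, the preimage in \<open>L\<close> of the Fitting null
  component of \<open>ad (x + A)\<close> on \<open>L/A\<close>. The exponent may depend on
  \<open>y\<close>; in finite dimension, equality with \<open>carrier L\<close> still means that
  \<open>x\<close> is ad-nilpotent modulo \<open>A\<close>.\<close>

definition fitting_null :: "'b set \<Rightarrow> 'b \<Rightarrow> 'b set" where
  "fitting_null A x = {y \<in> carrier L. \<exists>n. (lbr L x ^^ n) y \<in> A}"

text \<open>By the Leibniz rule, one application of \<open>ad x\<close> to \<open>[y,z]\<close>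
  gives two brackets whose exponents add up to one less, so induction on \<open>i + j\<close> works.
  Once an exponent is 0, the bracket already lies in the ideal \<open>A\<close>.\<close>

lemma ad_pow_lbr:
  assumes A: "lie_ideal F L A" and x: "x \<in> carrier L"
  shows "\<lbrakk>y \<in> carrier L; z \<in> carrier L; (lbr L x ^^ i) y \<in> A; (lbr L x ^^ j) z \<in> A\<rbrakk> \<Longrightarrow>
    (lbr L x ^^ (i + j)) (lbr L y z) \<in> A"
proof (induction "i + j" arbitrary: i j y z)
  case 0
  thus ?case using ideal_lbr_left[OF A] by simp
next
  case (Suc n)
  show ?case
  proof (cases "i = 0 \<or> j = 0")
    case True
    hence "lbr L y z \<in> A" using Suc.prems ideal_lbr_left[OF A] ideal_lbr_right[OF A] by auto
    with ideal_lbr_right[OF A x] show ?thesis by (rule ad_pow_invariant)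
  next
    case False
    then obtain i' j' where ij: "i = Suc i'" "j = Suc j'" by (meson not0_implies_Suc)
    have "(lbr L x ^^ (i' + j)) (lbr L (lbr L x y) z) \<in> A"
      using Suc.prems Suc.hyps(2) ij x by (intro Suc.hyps(1)) (auto simp: lbr_closed funpow_swap1)
    moreover have "(lbr L x ^^ (i + j')) (lbr L y (lbr L x z)) \<in> A"
      using Suc.prems Suc.hyps(2) ij x by (intro Suc.hyps(1)) (auto simp: lbr_closed funpow_swap1)
    moreover have "i' + j = n" "i + j' = n" "i + j = Suc n" using Suc.hyps(2) ij by auto
    ultimately have "(lbr L x ^^ n) (lbr L x (lbr L y z)) \<in> A"
      using x Suc.prems
      by (simp add: lbr_leibniz[OF x Suc.prems(1,2)] lbr_closed ad_pow_add subspace_add[OF ideal_subspace[OF A]])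
    thus ?thesis using \<open>i + j = Suc n\<close> by (simp add: funpow_swap1)
  qed
qed

lemma fitting_null_subalgebra:
  assumes A: "lie_ideal F L A" and x: "x \<in> carrier L"
  shows "lie_subalgebra F L (fitting_null A x)"
proof -
  have "y \<oplus>\<^bsub>L\<^esub> z \<in> fitting_null A x" if "y \<in> fitting_null A x" "z \<in> fitting_null A x" for y z
  proof -
    from that obtain m n where yz: "y \<in> carrier L" "z \<in> carrier L"
      and mn: "(lbr L x ^^ m) y \<in> A" "(lbr L x ^^ n) z \<in> A"
      by (auto simp: fitting_null_def)
    have "(lbr L x ^^ (max m n)) (y \<oplus>\<^bsub>L\<^esub> z) \<in> A"
      using ad_pow_mono[OF A x mn(1), of "max m n"] ad_pow_mono[OF A x mn(2), of "max m n"] x yz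
      by (simp add: ad_pow_add subspace_add[OF ideal_subspace[OF A]])
    thus ?thesis using yz by (auto simp: fitting_null_def)
  qed
  moreover have "a \<odot>\<^bsub>L\<^esub> y \<in> fitting_null A x" if "a \<in> carrier F" "y \<in> fitting_null A x" for a y
    using that x ad_pow_smult subspace_smult[OF ideal_subspace[OF A]]
    unfolding fitting_null_def by fastforce
  moreover have "lbr L y z \<in> fitting_null A x" if "y \<in> fitting_null A x" "z \<in> fitting_null A x" for y z
    using that ad_pow_lbr[OF A x] lbr_closed unfolding fitting_null_def by blast
  moreover have "\<zero>\<^bsub>L\<^esub> \<in> fitting_null A x"
    using subspace_zero[OF ideal_subspace[OF A]]
    by (auto simp: fitting_null_def intro!: exI[of _ 0])
  moreover have "fitting_null A x \<subseteq> carrier L" by (auto simp: fitting_null_def)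
  ultimately show ?thesis unfolding lie_subalgebra_def subspace_iff by blast
qed

lemma fitting_null_upper: "A \<subseteq> carrier L \<Longrightarrow> A \<subseteq> fitting_null A x"
  by (auto simp: fitting_null_def intro!: exI[of _ 0])

lemma fitting_null_self:
  assumes "lie_ideal F L A" "x \<in> carrier L"
  shows "x \<in> fitting_null A x"
  using assms subspace_zero[OF ideal_subspace]
  by (auto simp: fitting_null_def lbr_alternating intro!: exI[of _ 1])

lemma subspace_ad_pow_image:
  assumes x: "x \<in> carrier L"
  shows "subspace F ((lbr L x ^^ n) ` carrier L) L"
  unfolding subspace_iff
proof (intro conjI ballI)
  show "(lbr L x ^^ n) ` carrier L \<subseteq> carrier L" using x ad_pow_closed by auto
  have "(lbr L x ^^ n) \<zero>\<^bsub>L\<^esub> = \<zero>\<^bsub>L\<^esub>" by (induction n) (auto simp: lbr_zero_right x)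
  thus "\<zero>\<^bsub>L\<^esub> \<in> (lbr L x ^^ n) ` carrier L" by (metis M.zero_closed imageI)
qed (use x in \<open>auto simp flip: ad_pow_add ad_pow_smult\<close>)

text \<open>The images of the powers of \<open>ad x\<close> stabilise, and every positive power has image inside \<open>B\<close>.\<close>

lemma fitting_decomposition:
  assumes fd: "fin_dim" and A: "lie_ideal F L A" and B: "lie_ideal F L B" and x: "x \<in> B"
  shows "carrier L = fitting_null A x <+>\<^bsub>L\<^esub> B"
proof
  have xL: "x \<in> carrier L" using x B ideal_subset by blast
  have N: "subspace F (fitting_null A x) L"
    using fitting_null_subalgebra[OF A xL] subalgebra_subspace by blast
  show "fitting_null A x <+>\<^bsub>L\<^esub> B \<subseteq> carrier L"
    using subspace_subset[OF subspace_set_add[OF N ideal_subspace[OF B]]] .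
  show "carrier L \<subseteq> fitting_null A x <+>\<^bsub>L\<^esub> B"
  proof
    fix y assume y: "y \<in> carrier L"
    let ?T = "\<lambda>n. (lbr L x ^^ n) ` carrier L"
    have dec: "?T (Suc n) \<subseteq> ?T n" for n
      using xL lbr_closed by (auto simp: funpow_swap1)
    obtain n where n: "\<forall>m\<ge>n. ?T m = ?T n"
      using decreasing_subspaces_stabilise[of ?T, OF fd subspace_ad_pow_image[OF xL] dec] by blast
    \<comment> \<open>Stability persists from \<open>Suc n\<close> on, and a positive exponent means
      at least one bracket with \<open>x\<close>, which is what puts \<open>?b\<close> into
      \<open>B\<close>.\<close>
    define k where "k = Suc n"
    \<comment> \<open>Stability writes \<open>(ad x)^k y\<close> as \<open>(ad x)^(2k) z\<close>, so
      \<open>(ad x)^k\<close> kills \<open>y - (ad x)^k z\<close>.\<close>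
    have "(lbr L x ^^ k) y \<in> ?T (k + k)"
      using n[rule_format, of k] n[rule_format, of "k + k"] y unfolding k_def by auto
    then obtain z where z: "z \<in> carrier L" "(lbr L x ^^ k) y = (lbr L x ^^ (k + k)) z" by blast
    let ?b = "(lbr L x ^^ k) z"
    have b: "?b \<in> carrier L" using ad_pow_closed[OF xL z(1)] .
    have "?b \<in> B" unfolding k_def using z xL by (auto simp: ad_pow_closed intro: ideal_lbr_left[OF B x])
    have "(lbr L x ^^ k) (y \<oplus>\<^bsub>L\<^esub> \<ominus>\<^bsub>L\<^esub> ?b) = \<zero>\<^bsub>L\<^esub>"
    proof -
      have "(lbr L x ^^ k) (y \<oplus>\<^bsub>L\<^esub> \<ominus>\<^bsub>L\<^esub> ?b) \<oplus>\<^bsub>L\<^esub> (lbr L x ^^ k) ?b = (lbr L x ^^ k) y"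
        using y b xL by (simp flip: ad_pow_add add: M.a_assoc M.l_neg)
      moreover have "(lbr L x ^^ k) ?b = (lbr L x ^^ k) y" using z by (simp add: funpow_add)
      ultimately show ?thesis
        using M.add.l_cancel_one'[of "(lbr L x ^^ k) y" "(lbr L x ^^ k) (y \<oplus>\<^bsub>L\<^esub> \<ominus>\<^bsub>L\<^esub> ?b)"] y b xL ad_pow_closed by simp
    qed
    hence "y \<oplus>\<^bsub>L\<^esub> \<ominus>\<^bsub>L\<^esub> ?b \<in> fitting_null A x"
      using y b subspace_zero[OF ideal_subspace[OF A]]
      by (auto simp: fitting_null_def intro!: exI[of _ k])
    moreover have "y = (y \<oplus>\<^bsub>L\<^esub> \<ominus>\<^bsub>L\<^esub> ?b) \<oplus>\<^bsub>L\<^esub> ?b" using y b by (simp add: M.a_assoc M.l_neg)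
    ultimately show "y \<in> fitting_null A x <+>\<^bsub>L\<^esub> B"
      using \<open>?b \<in> B\<close> by (auto simp: set_add_def')
  qed
qed

end

section \<open>Engel's theorem modulo an ideal\<close>

context lie_algebra
begin

lemma maximal_subalgebra_between:
  assumes fd: "fin_dim" and H: "lie_subalgebra F L H" "H \<subset> K" and K: "lie_subalgebra F L K"
  obtains M where "H \<subseteq> M" "lie_subalgebra F L M" "M \<subset> K"
    "\<And>U. \<lbrakk>lie_subalgebra F L U; M \<subset> U; U \<subseteq> K\<rbrakk> \<Longrightarrow> U = K"
proof -
  obtain M where "H \<subseteq> M" "maximal M (\<lambda>U. lie_subalgebra F L U \<and> U \<subset> K)"
    using maximal_subspace_exists[OF fd, of "\<lambda>U. lie_subalgebra F L U \<and> U \<subset> K" H]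
      H subalgebra_subspace by auto
  thus thesis by (intro that[of M]) (auto simp: maximal_def)
qed

lemma maximal_subalgebraD:
  assumes "maximal_subalgebra F L M"
  shows "lie_subalgebra F L M" "M \<noteq> carrier L"
    "\<lbrakk>lie_subalgebra F L U; M \<subset> U\<rbrakk> \<Longrightarrow> U = carrier L"
  using assms by (auto simp: maximal_subalgebra_def maximal_def)

lemma maximal_subalgebra_exists:
  assumes fd: "fin_dim" and H: "lie_subalgebra F L H" "H \<noteq> carrier L"
  obtains M where "H \<subseteq> M" "maximal_subalgebra F L M"
  using maximal_subspace_exists[OF fd, of "\<lambda>U. lie_subalgebra F L U \<and> U \<noteq> carrier L" H]
    H subalgebra_subspace unfolding maximal_subalgebra_def by blast

text \<open>The bracket is linear in each argument. Consequently a claim that brackets with a fixed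
  \<open>v\<close> land in \<open>W\<close> may be checked on a spanning set.\<close>

lemma subspace_normaliser:
  assumes A: "subspace F W L" and K: "subspace F V L" and v: "v \<in> carrier L"
  shows "subspace F {u \<in> V. lbr L v u \<in> W} L" "subspace F {u \<in> V. lbr L u v \<in> W} L"
  using assms subspace_subset[OF K]
  by (auto simp: subspace_iff lbr_zero_right lbr_zero_left subset_iff lbr_add_right
      lbr_add_left lbr_smult_right lbr_smult_left)

text \<open>Since \<open>v\<close> normalises \<open>H\<close> and \<open>[v,v] = 0\<close>, all
  brackets of \<open>H + Fv\<close> fall into \<open>H\<close>. The last claim says that
  \<open>U\<close> is the least subspace containing \<open>H\<close> and \<open>v\<close>.\<close>

lemma subalgebra_adjoin:
  assumes H: "lie_subalgebra F L H" and v: "v \<in> carrier L"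
    and norm: "\<forall>h\<in>H. lbr L h v \<in> H"
  defines "U \<equiv> H <+>\<^bsub>L\<^esub> {a \<odot>\<^bsub>L\<^esub> v | a. a \<in> carrier F}"
  shows "lie_subalgebra F L U" "H \<subseteq> U" "v \<in> U" "\<And>x y. \<lbrakk>x \<in> U; y \<in> U\<rbrakk> \<Longrightarrow> lbr L x y \<in> H"
    "\<And>X. \<lbrakk>subspace F X L; H \<subseteq> X; v \<in> X\<rbrakk> \<Longrightarrow> U \<subseteq> X"
proof -
  let ?S = "{a \<odot>\<^bsub>L\<^esub> v | a. a \<in> carrier F}"
  have Hs: "subspace F H L" using H by (rule subalgebra_subspace)
  have S: "subspace F ?S L"
    unfolding subspace_iff
  proof (intro conjI ballI)
    show "\<zero>\<^bsub>L\<^esub> \<in> ?S" using v by (auto intro!: exI[of _ "\<zero>\<^bsub>F\<^esub>"])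
    fix x y assume "x \<in> ?S" "y \<in> ?S"
    thus "x \<oplus>\<^bsub>L\<^esub> y \<in> ?S" using v by (auto simp flip: smult_l_distr)
  next
    fix a x assume "a \<in> carrier F" "x \<in> ?S"
    thus "a \<odot>\<^bsub>L\<^esub> x \<in> ?S" using v by (auto simp flip: smult_assoc1)
  qed (use v in auto)
  show HU: "H \<subseteq> U" unfolding U_def using set_add_upper_left[OF Hs S] .
  have "v = \<one>\<^bsub>F\<^esub> \<odot>\<^bsub>L\<^esub> v" using v by simp
  hence "v \<in> ?S" by blast
  thus "v \<in> U" unfolding U_def using set_add_upper_right[OF Hs S] by blast
  show lbr: "lbr L x y \<in> H" if xy: "x \<in> U" "y \<in> U" for x y
  proof -
    obtain h a k b where h: "h \<in> H" "k \<in> H" and ab: "a \<in> carrier F" "b \<in> carrier F"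
      and xy: "x = h \<oplus>\<^bsub>L\<^esub> a \<odot>\<^bsub>L\<^esub> v" "y = k \<oplus>\<^bsub>L\<^esub> b \<odot>\<^bsub>L\<^esub> v"
      using xy unfolding U_def by (auto elim!: set_addE)
    have c: "h \<in> carrier L" "k \<in> carrier L" using h subspace_subset[OF Hs] by auto
    have "lbr L v k \<in> H"
      using lbr_skew[of k v] subspace_neg[OF Hs norm[rule_format, OF h(2)]] c v by simp
    hence "a \<odot>\<^bsub>L\<^esub> lbr L v k \<in> H" "b \<odot>\<^bsub>L\<^esub> lbr L h v \<in> H" "lbr L h k \<in> H"
      using norm h ab subspace_smult[OF Hs] subalgebra_lbr[OF H] by auto
    moreover have "lbr L x y = (lbr L h k \<oplus>\<^bsub>L\<^esub> b \<odot>\<^bsub>L\<^esub> lbr L h v) \<oplus>\<^bsub>L\<^esub> a \<odot>\<^bsub>L\<^esub> lbr L v k"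
      using c v ab unfolding xy
      by (simp add: lbr_add_left lbr_add_right lbr_closed lbr_smult_left lbr_smult_right
          lbr_alternating[OF v] M.a_ac)
    ultimately show ?thesis using subspace_add[OF Hs] by simp
  qed
  show "lie_subalgebra F L U"
    using lbr HU subspace_set_add[OF Hs S] unfolding U_def lie_subalgebra_def by blast
  show "U \<subseteq> X" if X: "subspace F X L" "H \<subseteq> X" "v \<in> X" for X
    unfolding U_def using X subspace_smult[OF X(1)] by (intro set_add_least[OF X(1)]) auto
qed

text \<open>Engel's theorem for \<open>K/A\<close> acting on \<open>V/W\<close>. In the induction, a maximal subalgebra \<open>H\<close> of \<open>K\<close> is
  normalised by some \<open>v \<in> K - H\<close>: apply the induction hypothesis to \<open>H\<close> acting on \<open>K/H\<close>.\<close>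

lemma engel_null_vector:
  assumes fd: "fin_dim" and A: "lie_ideal F L A"
  shows "\<lbrakk>lie_subalgebra F L K; A \<subseteq> K; \<And>x. x \<in> K \<Longrightarrow> fitting_null A x = carrier L;
      subspace F V L; subspace F W L; A \<subseteq> W; \<not> V \<subseteq> W;
      \<And>x v. \<lbrakk>x \<in> K; v \<in> V\<rbrakk> \<Longrightarrow> lbr L x v \<in> V; \<And>x w. \<lbrakk>x \<in> K; w \<in> W\<rbrakk> \<Longrightarrow> lbr L x w \<in> W\<rbrakk> \<Longrightarrow>
    \<exists>v\<in>V - W. \<forall>x\<in>K. lbr L x v \<in> W"
proof (induction "subset_rank K" arbitrary: K V W rule: less_induct)
  case less
  note K = less.prems(1,2) and nilp = less.prems(3) and V = less.prems(4) and W = less.prems(5,6)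
    and VW = less.prems(7) and stV = less.prems(8) and stW = less.prems(9)
  have sub: "K \<subseteq> carrier L" "V \<subseteq> carrier L" "W \<subseteq> carrier L"
    using K V W subspace_subset subalgebra_subspace by auto
  show ?case
  proof (cases "K = A")
    \<comment> \<open>In the base case \<open>K = A\<close> any vector of \<open>V\<close> outside
      \<open>W\<close> works, because brackets with the ideal \<open>A\<close> stay in
      \<open>A\<close>, hence in \<open>W\<close>.\<close>
    case True
    obtain v where "v \<in> V" "v \<notin> W" using VW by blast
    moreover have "lbr L x v \<in> W" if "x \<in> K" for x
      using ideal_lbr_left[OF A, of x v] that True W sub \<open>v \<in> V\<close> by blast
    ultimately show ?thesis by blast
  next
    case False
    hence AK: "A \<subset> K" using K by blast
    obtain H where H: "A \<subseteq> H" "lie_subalgebra F L H" "H \<subset> K"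
      and Hmax: "\<And>U. \<lbrakk>lie_subalgebra F L U; H \<subset> U; U \<subseteq> K\<rbrakk> \<Longrightarrow> U = K"
      using maximal_subalgebra_between[OF fd ideal_subalgebra[OF A] AK K(1)] by blast
    have rank: "subset_rank H < subset_rank K"
      using subset_rank_strict_mono[OF fd subalgebra_subspace[OF H(2)] H(3) sub(1)] .
    have nilpH: "fitting_null A x = carrier L" if "x \<in> H" for x using nilp that H by blast
    have "\<exists>v\<in>K - H. \<forall>x\<in>H. lbr L x v \<in> H"
      by (rule less.hyps[OF rank H(2,1) nilpH subalgebra_subspace[OF K(1)]
            subalgebra_subspace[OF H(2)] H(1)])
        (use H subalgebra_lbr[OF K(1)] subalgebra_lbr[OF H(2)] in auto)
    then obtain v where v: "v \<in> K" "v \<notin> H" and norm: "\<forall>h\<in>H. lbr L h v \<in> H" by blast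
    have vL: "v \<in> carrier L" using v sub by blast
    note adj = subalgebra_adjoin[OF H(2) vL norm]
    \<comment> \<open>\<open>H + Fv\<close> is a subalgebra of \<open>K\<close> strictly above
      \<open>H\<close>, so maximality of \<open>H\<close> makes it all of \<open>K\<close>.\<close>
    have KE: "H <+>\<^bsub>L\<^esub> {a \<odot>\<^bsub>L\<^esub> v | a. a \<in> carrier F} = K"
      using adj(1-3) adj(5)[OF subalgebra_subspace[OF K(1)]] H v by (intro Hmax) auto
    \<comment> \<open>The second use of the induction hypothesis, now for \<open>H\<close> acting on
      \<open>V/W\<close>.\<close>
    obtain u where u: "u \<in> V" "u \<notin> W" and Hu: "\<And>h. h \<in> H \<Longrightarrow> lbr L h u \<in> W"
    proof -
      have "\<exists>u\<in>V - W. \<forall>x\<in>H. lbr L x u \<in> W"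
        by (rule less.hyps[OF rank H(2,1) nilpH V W VW]) (use stV stW H in auto)
      thus thesis using that by blast
    qed
    \<comment> \<open>Vectors killed by \<open>H\<close> modulo \<open>W\<close> are stable under
      \<open>ad v\<close>: in \<open>[h,[v,w]] = [[h,v],w] + [v,[h,w]]\<close> the element
      \<open>[h,v]\<close> lies in \<open>H\<close> again.\<close>
    have pow: "(lbr L v ^^ n) u \<in> V \<and> (\<forall>h\<in>H. lbr L h ((lbr L v ^^ n) u) \<in> W)" for n
    proof (induction n)
      case 0
      show ?case using u Hu by simp
    next
      case (Suc n)
      let ?w = "(lbr L v ^^ n) u"
      have "lbr L h (lbr L v ?w) \<in> W" if h: "h \<in> H" for h
      proof -
        have "h \<in> carrier L" "?w \<in> carrier L" using h H Suc sub by auto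
        hence "lbr L h (lbr L v ?w) = lbr L (lbr L h v) ?w \<oplus>\<^bsub>L\<^esub> lbr L v (lbr L h ?w)"
          using vL by (intro lbr_leibniz)
        thus ?thesis using Suc norm h stW[OF v(1)] subspace_add[OF W(1)] by simp
      qed
      thus ?case using Suc stV[OF v(1)] by simp
    qed
    have "u \<in> fitting_null A v" using nilp[OF v(1)] u sub by blast
    then obtain N where "(lbr L v ^^ N) u \<in> W" using W by (auto simp: fitting_null_def)
    \<comment> \<open>The last vector in the sequence \<open>(ad v)^i u\<close> before it enters
      \<open>W\<close> is killed modulo \<open>W\<close> by \<open>v\<close> as well as by
      \<open>H\<close>. It exists because \<open>u\<close> itself is outside
      \<open>W\<close>.\<close>
    define n where "n = (LEAST n. (lbr L v ^^ n) u \<in> W)"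
    have n: "(lbr L v ^^ n) u \<in> W" unfolding n_def by (rule LeastI) fact
    have "n \<noteq> 0" using n u by (metis funpow_0)
    then obtain m where m: "n = Suc m" using not0_implies_Suc by blast
    let ?w = "(lbr L v ^^ m) u"
    have "?w \<notin> W" using m not_less_Least[of m "\<lambda>n. (lbr L v ^^ n) u \<in> W"] unfolding n_def by simp
    \<comment> \<open>The annihilator of \<open>?w\<close> modulo \<open>W\<close> is a subspace
      containing \<open>H\<close> and \<open>v\<close>, hence it contains
      \<open>K = H + Fv\<close>.\<close>
    moreover have "K \<subseteq> {x \<in> carrier L. lbr L x ?w \<in> W}"
      unfolding KE[symmetric]
    proof (rule adj(5)[OF subspace_normaliser(2)[OF W(1) subspace_carrier]])
      show "?w \<in> carrier L" using pow sub by blast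
      show "H \<subseteq> {x \<in> carrier L. lbr L x ?w \<in> W}" using pow H sub by blast
      show "v \<in> {x \<in> carrier L. lbr L x ?w \<in> W}" using n m vL by simp
    qed
    ultimately show ?thesis using pow by blast
  qed
qed

text \<open>For \<open>H\<close> a maximal subalgebra of \<open>K\<close> above \<open>A\<close>,
  Engel's theorem for \<open>H\<close> acting on \<open>K/H\<close> yields a normalising
  \<open>v\<close> outside \<open>H\<close>. Then \<open>K = H + Fv\<close>, and all brackets of
  \<open>K\<close> lie in \<open>H\<close>.\<close>

lemma engel_not_perfect:
  assumes fd: "fin_dim" and A: "lie_ideal F L A" and K: "lie_subalgebra F L K" and AK: "A \<subset> K"
    and nilp: "\<And>x. x \<in> K \<Longrightarrow> fitting_null A x = carrier L"
  obtains H where "subspace F H L" "A \<subseteq> H" "H \<subset> K" "\<And>x y. \<lbrakk>x \<in> K; y \<in> K\<rbrakk> \<Longrightarrow> lbr L x y \<in> H"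
proof -
  obtain H where H: "A \<subseteq> H" "lie_subalgebra F L H" "H \<subset> K"
    and Hmax: "\<And>U. \<lbrakk>lie_subalgebra F L U; H \<subset> U; U \<subseteq> K\<rbrakk> \<Longrightarrow> U = K"
    using maximal_subalgebra_between[OF fd ideal_subalgebra[OF A] AK K] by blast
  have "\<exists>v\<in>K - H. \<forall>x\<in>H. lbr L x v \<in> H"
    by (rule engel_null_vector[OF fd A H(2,1) nilp subalgebra_subspace[OF K]
          subalgebra_subspace[OF H(2)] H(1)])
      (use H subalgebra_lbr[OF K] subalgebra_lbr[OF H(2)] in auto)
  then obtain v where v: "v \<in> K" "v \<notin> H" and norm: "\<forall>h\<in>H. lbr L h v \<in> H" by blast
  have vL: "v \<in> carrier L" using v subspace_subset[OF subalgebra_subspace[OF K]] by blast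
  note adj = subalgebra_adjoin[OF H(2) vL norm]
  have KE: "H <+>\<^bsub>L\<^esub> {a \<odot>\<^bsub>L\<^esub> v | a. a \<in> carrier F} = K"
    using adj(1-3) adj(5)[OF subalgebra_subspace[OF K]] H v by (intro Hmax) auto
  show thesis
    using that[OF subalgebra_subspace[OF H(2)] H(1,3)] adj(4) unfolding KE by blast
qed

end

section \<open>Quotients and chief factors\<close>

context lie_algebra
begin

context
  fixes D assumes D: "lie_ideal F L D"
begin

text \<open>Makes the coset calculus for abelian groups available for \<open>D\<close>.\<close>

lemma ideal_abelian_subgroup: "abelian_subgroup D L"
proof (rule abelian_subgroupI3)
  note Ds = ideal_subspace[OF D]
  show "additive_subgroup D L"
    by (rule additive_subgroup.intro, rule M.add.subgroupI)
      (use ideal_subset[OF D] subspace_zero[OF Ds] subspace_neg[OF Ds] subspace_add[OF Ds] in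
        \<open>auto simp: a_inv_def[symmetric]\<close>)
qed (rule M.abelian_group_axioms)

interpretation D: abelian_subgroup D L by (rule ideal_abelian_subgroup)

lemma coset_eqI:
  assumes "d \<in> D" "x \<in> carrier L"
  shows "D +>\<^bsub>L\<^esub> (d \<oplus>\<^bsub>L\<^esub> x) = D +>\<^bsub>L\<^esub> x"
  using D.a_repr_independence'[of "d \<oplus>\<^bsub>L\<^esub> x" x] assms by (auto simp: a_r_coset_def')

lemma coset_eq_iff:
  assumes x: "x \<in> carrier L" and y: "y \<in> carrier L"
  shows "D +>\<^bsub>L\<^esub> x = D +>\<^bsub>L\<^esub> y \<longleftrightarrow> (\<exists>d\<in>D. x = d \<oplus>\<^bsub>L\<^esub> y)"
proof
  assume "D +>\<^bsub>L\<^esub> x = D +>\<^bsub>L\<^esub> y"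
  hence "x \<in> D +>\<^bsub>L\<^esub> y" using D.a_rcos_self[OF x] by simp
  thus "\<exists>d\<in>D. x = d \<oplus>\<^bsub>L\<^esub> y" unfolding a_r_coset_def' by blast
qed (use coset_eqI y in blast)

lemma coset_eq_ideal_iff: "x \<in> carrier L \<Longrightarrow> D +>\<^bsub>L\<^esub> x = D \<longleftrightarrow> x \<in> D"
  using D.a_rcos_self M.a_coset_join2 D.a_subgroup by blast

lemma coset_eq_ideal: "x \<in> D \<Longrightarrow> D +>\<^bsub>L\<^esub> x = D"
  using coset_eq_ideal_iff ideal_subset[OF D] by blast

lemma carrier_quotient: "carrier (lie_quotient L D) = (\<lambda>x. D +>\<^bsub>L\<^esub> x) ` carrier L"
  by (auto simp: lie_quotient_def A_RCOSETS_def')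

lemma zero_quotient: "\<zero>\<^bsub>lie_quotient L D\<^esub> = D"
  by (simp add: lie_quotient_def)

lemma add_quotient:
  "\<lbrakk>x \<in> carrier L; y \<in> carrier L\<rbrakk> \<Longrightarrow>
    (D +>\<^bsub>L\<^esub> x) \<oplus>\<^bsub>lie_quotient L D\<^esub> (D +>\<^bsub>L\<^esub> y) = D +>\<^bsub>L\<^esub> (x \<oplus>\<^bsub>L\<^esub> y)"
  by (simp add: lie_quotient_def D.a_rcos_sum)

text \<open>Changing the representative by \<open>d\<close> in \<open>D\<close> changes the multiple
  by \<open>a d\<close>, again in \<open>D\<close>, so the union in \<open>lie_quotient\<close> runs
  over a single coset.\<close>

lemma smult_quotient:
  assumes a: "a \<in> carrier F" and x: "x \<in> carrier L"
  shows "a \<odot>\<^bsub>lie_quotient L D\<^esub> (D +>\<^bsub>L\<^esub> x) = D +>\<^bsub>L\<^esub> (a \<odot>\<^bsub>L\<^esub> x)"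
proof -
  have eq: "D +>\<^bsub>L\<^esub> (a \<odot>\<^bsub>L\<^esub> x') = D +>\<^bsub>L\<^esub> (a \<odot>\<^bsub>L\<^esub> x)" if x': "x' \<in> D +>\<^bsub>L\<^esub> x" for x'
  proof -
    obtain d where d: "d \<in> D" "x' = d \<oplus>\<^bsub>L\<^esub> x"
      using x' by (auto simp: a_r_coset_def')
    thus ?thesis using a x ideal_subset[OF D] subspace_smult[OF ideal_subspace[OF D] a d(1)]
      by (auto simp: smult_r_distr coset_eqI subset_iff)
  qed
  have "(\<Union>x'\<in>D +>\<^bsub>L\<^esub> x. D +>\<^bsub>L\<^esub> (a \<odot>\<^bsub>L\<^esub> x')) = D +>\<^bsub>L\<^esub> (a \<odot>\<^bsub>L\<^esub> x)"
    using D.a_rcos_self[OF x] eq by (intro SUP_eq_const) blast+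
  thus ?thesis by (simp add: lie_quotient_def)
qed

text \<open>Replacing \<open>x\<close>, \<open>y\<close> by \<open>d + x\<close>,
  \<open>e + y\<close> adds the terms \<open>[d,e]\<close>, \<open>[d,y]\<close> and
  \<open>[x,e]\<close>, all in the ideal \<open>D\<close>; again the defining union collapses to one
  coset.\<close>

lemma lbr_quotient:
  assumes x: "x \<in> carrier L" and y: "y \<in> carrier L"
  shows "lbr (lie_quotient L D) (D +>\<^bsub>L\<^esub> x) (D +>\<^bsub>L\<^esub> y) = D +>\<^bsub>L\<^esub> lbr L x y"
proof -
  have eq: "D +>\<^bsub>L\<^esub> lbr L x' y' = D +>\<^bsub>L\<^esub> lbr L x y"
    if x': "x' \<in> D +>\<^bsub>L\<^esub> x" and y': "y' \<in> D +>\<^bsub>L\<^esub> y" for x' y'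
  proof -
    obtain d where d: "d \<in> D" "x' = d \<oplus>\<^bsub>L\<^esub> x"
      using x' by (auto simp: a_r_coset_def')
    obtain e where e: "e \<in> D" "y' = e \<oplus>\<^bsub>L\<^esub> y"
      using y' by (auto simp: a_r_coset_def')
    have c: "d \<in> carrier L" "e \<in> carrier L" using d e ideal_subset[OF D] by auto
    have "lbr L x' y' = (lbr L d e \<oplus>\<^bsub>L\<^esub> (lbr L d y \<oplus>\<^bsub>L\<^esub> lbr L x e)) \<oplus>\<^bsub>L\<^esub> lbr L x y"
      using d e c x y by (simp add: lbr_add_left lbr_add_right lbr_closed M.a_ac)
    moreover have "lbr L d e \<oplus>\<^bsub>L\<^esub> (lbr L d y \<oplus>\<^bsub>L\<^esub> lbr L x e) \<in> D"
      using d e c x y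
      by (intro subspace_add[OF ideal_subspace[OF D]] ideal_lbr_left[OF D] ideal_lbr_right[OF D]) auto
    ultimately show ?thesis using coset_eqI lbr_closed x y by simp
  qed
  have "(\<Union>x'\<in>D +>\<^bsub>L\<^esub> x. \<Union>y'\<in>D +>\<^bsub>L\<^esub> y. D +>\<^bsub>L\<^esub> lbr L x' y') = D +>\<^bsub>L\<^esub> lbr L x y"
    using D.a_rcos_self[OF x] D.a_rcos_self[OF y] eq by (intro SUP_eq_const) blast+
  thus ?thesis by (simp add: lie_quotient_def)
qed

lemma ad_pow_quotient:
  "\<lbrakk>x \<in> carrier L; y \<in> carrier L\<rbrakk> \<Longrightarrow>
    (lbr (lie_quotient L D) (D +>\<^bsub>L\<^esub> x) ^^ n) (D +>\<^bsub>L\<^esub> y) = D +>\<^bsub>L\<^esub> (lbr L x ^^ n) y"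
  by (induction n) (auto simp: lbr_quotient ad_pow_closed)

text \<open>Allows \<open>subspace_iff\<close> to be used in \<open>L/D\<close>, where ideals and
  subalgebras are built on subspaces.\<close>

lemma vectorspace_quotient: "vectorspace F (lie_quotient L D)"
proof -
  let ?Q = "lie_quotient L D"
  have D0: "D = D +>\<^bsub>L\<^esub> \<zero>\<^bsub>L\<^esub>" using ideal_subset[OF D] by simp
  note q = carrier_quotient add_quotient smult_quotient
  have zero: "\<zero>\<^bsub>?Q\<^esub> = D +>\<^bsub>L\<^esub> \<zero>\<^bsub>L\<^esub>" using D0 zero_quotient by simp
  show ?thesis
  proof (rule vs_criteria)
    show "field F" by (rule field.field_axioms)
    show "\<forall>v\<in>carrier ?Q. \<exists>w\<in>carrier ?Q. v \<oplus>\<^bsub>?Q\<^esub> w = \<zero>\<^bsub>?Q\<^esub>"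
    proof
      fix v assume "v \<in> carrier ?Q"
      then obtain x where x: "x \<in> carrier L" "v = D +>\<^bsub>L\<^esub> x" by (auto simp: q)
      hence "v \<oplus>\<^bsub>?Q\<^esub> (D +>\<^bsub>L\<^esub> (\<ominus>\<^bsub>L\<^esub> x)) = \<zero>\<^bsub>?Q\<^esub>" by (simp add: q zero M.r_neg)
      thus "\<exists>w\<in>carrier ?Q. v \<oplus>\<^bsub>?Q\<^esub> w = \<zero>\<^bsub>?Q\<^esub>" using x by (auto simp: q)
    qed
    show "\<forall>v w. v \<in> carrier ?Q \<and> w \<in> carrier ?Q \<longrightarrow> v \<oplus>\<^bsub>?Q\<^esub> w = w \<oplus>\<^bsub>?Q\<^esub> v"
      using M.a_comm by (auto simp: q)
  qed (auto simp: q zero M.a_assoc smult_assoc1 smult_l_distr smult_r_distr)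
qed

lemma subspace_quotient_image:
  assumes U: "subspace F U L"
  shows "subspace F (quotient_image L D U) (lie_quotient L D)"
proof -
  have D0: "D = D +>\<^bsub>L\<^esub> \<zero>\<^bsub>L\<^esub>" using ideal_subset[OF D] by simp
  have c: "x \<in> U \<Longrightarrow> x \<in> carrier L" for x using subspace_subset[OF U] by blast
  show ?thesis
    unfolding vectorspace.subspace_iff[OF vectorspace_quotient] quotient_image_def zero_quotient
  proof (intro conjI ballI)
    show "D \<in> (\<lambda>x. D +>\<^bsub>L\<^esub> x) ` U" using D0 subspace_zero[OF U] by blast
  qed (use c U in \<open>auto simp: add_quotient smult_quotient carrier_quotient subspace_add subspace_smult\<close>)
qed

lemma subalgebra_quotient_image:
  assumes U: "lie_subalgebra F L U"
  shows "lie_subalgebra F (lie_quotient L D) (quotient_image L D U)"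
  using subspace_quotient_image[OF subalgebra_subspace[OF U]] subalgebra_lbr[OF U]
    subspace_subset[OF subalgebra_subspace[OF U]]
  by (auto simp: lie_subalgebra_def quotient_image_def lbr_quotient subset_iff)

lemma ideal_quotient_image:
  assumes I: "lie_ideal F L I"
  shows "lie_ideal F (lie_quotient L D) (quotient_image L D I)"
  using subspace_quotient_image[OF ideal_subspace[OF I]] ideal_lbr_right[OF I] ideal_subset[OF I]
  by (auto simp: lie_ideal_def quotient_image_def carrier_quotient lbr_quotient subset_iff)

text \<open>One half of the correspondence theorem: every ideal of \<open>L/D\<close> comes from its
  full preimage, which contains \<open>D\<close> because \<open>D\<close> is the zero coset.\<close>

lemma ideal_quotient_preimage:
  assumes J: "lie_ideal F (lie_quotient L D) J"
  defines "I \<equiv> {x \<in> carrier L. D +>\<^bsub>L\<^esub> x \<in> J}"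
  shows "lie_ideal F L I" "D \<subseteq> I" "J = quotient_image L D I"
proof -
  have sub: "subspace F J (lie_quotient L D)" using J by (simp add: lie_ideal_def)
  note Q = sub[unfolded vectorspace.subspace_iff[OF vectorspace_quotient] zero_quotient]
  have add: "D +>\<^bsub>L\<^esub> (x \<oplus>\<^bsub>L\<^esub> y) \<in> J" if "x \<in> I" "y \<in> I" for x y
    using Q that add_quotient[of x y] unfolding I_def by fastforce
  have smult: "D +>\<^bsub>L\<^esub> (a \<odot>\<^bsub>L\<^esub> x) \<in> J" if "a \<in> carrier F" "x \<in> I" for a x
    using Q that smult_quotient[of a x] unfolding I_def by fastforce
  have lbr: "D +>\<^bsub>L\<^esub> lbr L x y \<in> J" if "x \<in> carrier L" "y \<in> I" for x y
    using J that lbr_quotient[of x y] unfolding I_def lie_ideal_def carrier_quotient by fastforce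
  show DI: "D \<subseteq> I"
    using Q coset_eq_ideal ideal_subset[OF D] unfolding I_def by auto
  show "lie_ideal F L I"
    unfolding lie_ideal_def subspace_iff
  proof (intro conjI ballI)
    show "\<zero>\<^bsub>L\<^esub> \<in> I" using DI subspace_zero[OF ideal_subspace[OF D]] by blast
  qed (use add smult lbr in \<open>auto simp: I_def lbr_closed\<close>)
  show "J = quotient_image L D I"
    using Q unfolding I_def quotient_image_def carrier_quotient by auto
qed

text \<open>The other half of the correspondence: elements with the same coset differ by an element
  of \<open>D\<close>, which both subspaces contain.\<close>

lemma quotient_image_eq_iff:
  assumes I: "subspace F I L" "D \<subseteq> I" and J: "subspace F J L" "D \<subseteq> J"
  shows "quotient_image L D I = quotient_image L D J \<longleftrightarrow> I = J"
proof
  have *: "U \<subseteq> W" if U: "subspace F U L" and W: "subspace F W L" "D \<subseteq> W"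
    and sub: "quotient_image L D U \<subseteq> quotient_image L D W" for U W
  proof
    fix x assume x: "x \<in> U"
    then obtain y where y: "y \<in> W" "D +>\<^bsub>L\<^esub> x = D +>\<^bsub>L\<^esub> y"
      using sub unfolding quotient_image_def by blast
    hence "\<exists>d\<in>D. x = d \<oplus>\<^bsub>L\<^esub> y"
      using coset_eq_iff[of x y] x subspace_subset[OF U] subspace_subset[OF W(1)] by blast
    thus "x \<in> W" using subspace_add[OF W(1)] W(2) y by blast
  qed
  show "quotient_image L D I = quotient_image L D J \<Longrightarrow> I = J"
    using *[OF I(1) J] *[OF J(1) I] by blast
qed simp

text \<open>By the correspondence theorem, minimality of \<open>C/D\<close> only concerns the ideals
  of \<open>L\<close> between \<open>D\<close> and \<open>C\<close>.\<close>

lemma chief_factorI: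
  assumes C: "lie_ideal F L C" and DC: "D \<subset> C"
    and min: "\<And>I. \<lbrakk>lie_ideal F L I; D \<subset> I; I \<subseteq> C\<rbrakk> \<Longrightarrow> I = C"
  shows "chief_factor F L C D"
proof -
  have "(\<lambda>x. D +>\<^bsub>L\<^esub> x) ` D = (\<lambda>x. D) ` D" by (intro image_cong refl coset_eq_ideal)
  hence DD: "{D} = quotient_image L D D"
    unfolding quotient_image_def image_constant[OF subspace_zero[OF ideal_subspace[OF D]]] by (rule sym)
  have eq: "quotient_image L D I = {D} \<longleftrightarrow> I = D" if "lie_ideal F L I" "D \<subseteq> I" for I
    unfolding DD using that D by (intro quotient_image_eq_iff ideal_subspace) auto
  have "J = quotient_image L D C"
    if J: "J \<subseteq> quotient_image L D C" "lie_ideal F (lie_quotient L D) J" "J \<noteq> {D}" for J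
  proof -
    define I where "I = {x \<in> carrier L. D +>\<^bsub>L\<^esub> x \<in> J}"
    note I = ideal_quotient_preimage[OF J(2), folded I_def]
    \<comment> \<open>Intersecting with \<open>C\<close> makes the bound by \<open>C\<close>
      immediate; the image is still \<open>J\<close>, since \<open>J\<close> consists of cosets of
      elements of \<open>C\<close>.\<close>
    have IC: "lie_ideal F L (I \<inter> C)" "D \<subseteq> I \<inter> C" using I C DC by (auto intro: ideal_Int)
    have JI: "J = quotient_image L D (I \<inter> C)"
      using J(1) ideal_subset[OF C] unfolding quotient_image_def I_def by auto
    hence "I \<inter> C \<noteq> D" using eq[OF IC] J(3) by simp
    hence "I \<inter> C = C" using IC by (intro min) auto
    thus ?thesis using JI by simp
  qed
  moreover have "quotient_image L D C \<noteq> {D}" using eq[OF C] DC by blast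
  ultimately show ?thesis
    unfolding chief_factor_def minimal_ideal_def minimal_def zero_quotient
    using D C DC ideal_quotient_image[OF C] by blast
qed

text \<open>Moves the nil condition from \<open>L/D\<close> into \<open>L\<close>, where both
  directions of the theorem work with it.\<close>

lemma nil_subalgebra_quotient_iff:
  assumes U: "lie_subalgebra F L U"
  shows "nil_subalgebra F (lie_quotient L D) (quotient_image L D U) \<longleftrightarrow>
    (\<forall>x\<in>U. \<exists>n. \<forall>y\<in>carrier L. (lbr L x ^^ n) y \<in> D)"
proof -
  have "(\<forall>Y\<in>carrier (lie_quotient L D). (lbr (lie_quotient L D) (D +>\<^bsub>L\<^esub> x) ^^ n) Y = D) \<longleftrightarrow>
      (\<forall>y\<in>carrier L. (lbr L x ^^ n) y \<in> D)" if "x \<in> U" for x n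
    using that subspace_subset[OF subalgebra_subspace[OF U]]
    by (simp add: carrier_quotient ad_pow_quotient coset_eq_ideal_iff ad_pow_closed subset_iff)
  thus ?thesis
    using subalgebra_quotient_image[OF U]
    unfolding nil_subalgebra_def quotient_image_def zero_quotient by simp
qed

end

end

section \<open>Solvability and c-sections\<close>

context lie_algebra
begin

section \<open>The derived series\<close>

lemma derived_subset_iff:
  assumes U: "U \<subseteq> carrier L" and X: "subspace F X L"
  shows "lie_derived F L U \<subseteq> X \<longleftrightarrow> (\<forall>x\<in>U. \<forall>y\<in>U. lbr L x y \<in> X)"
proof -
  let ?S = "{lbr L x y | x y. x \<in> U \<and> y \<in> U}"
  have "?S \<subseteq> carrier L" using U lbr_closed by blast
  hence "?S \<subseteq> span ?S" by (rule in_own_span)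
  moreover have "?S \<subseteq> X \<Longrightarrow> span ?S \<subseteq> X" using X by (intro span_is_subset) auto
  ultimately show ?thesis unfolding lie_derived_def by blast
qed

lemma subspace_derived: "U \<subseteq> carrier L \<Longrightarrow> subspace F (lie_derived F L U) L"
  unfolding lie_derived_def by (rule span_is_subspace) (use lbr_closed in blast)

lemma lbr_derived:
  "\<lbrakk>U \<subseteq> carrier L; x \<in> U; y \<in> U\<rbrakk> \<Longrightarrow> lbr L x y \<in> lie_derived F L U"
  using derived_subset_iff[OF _ subspace_derived] by blast

lemma derived_ideal:
  assumes I: "lie_ideal F L I"
  shows "lie_ideal F L (lie_derived F L I)" "lie_derived F L I \<subseteq> I"
proof -
  let ?D = "lie_derived F L I"
  note IL = ideal_subset[OF I]
  note D = subspace_derived[OF IL]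
  show "?D \<subseteq> I"
    unfolding derived_subset_iff[OF IL ideal_subspace[OF I]] using IL ideal_lbr_right[OF I] by blast
  have "lbr L z u \<in> ?D" if z: "z \<in> carrier L" and u: "u \<in> ?D" for z u
  proof -
    \<comment> \<open>The elements that \<open>ad z\<close> sends into \<open>?D\<close> form a
      subspace, so only brackets \<open>[x,y]\<close> need checking, and there the Leibniz rule
      applies.\<close>
    have "?D \<subseteq> {u \<in> carrier L. lbr L z u \<in> ?D}"
      unfolding derived_subset_iff[OF IL subspace_normaliser(1)[OF D subspace_carrier z]]
    proof (intro ballI)
      fix x y assume xy: "x \<in> I" "y \<in> I"
      hence c: "x \<in> carrier L" "y \<in> carrier L" using IL by auto
      have "lbr L (lbr L z x) y \<in> ?D" "lbr L x (lbr L z y) \<in> ?D"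
        using xy z ideal_lbr_right[OF I] by (auto intro: lbr_derived[OF IL])
      thus "lbr L x y \<in> {u \<in> carrier L. lbr L z u \<in> ?D}"
        using lbr_leibniz[OF z c] c lbr_closed subspace_add[OF D] by simp
    qed
    thus ?thesis using u by blast
  qed
  thus "lie_ideal F L ?D" using D by (simp add: lie_ideal_def)
qed

lemma derived_series_ideal: "lie_ideal F L ((lie_derived F L ^^ n) (carrier L))"
  by (induction n) (auto intro: ideal_carrier derived_ideal)

text \<open>In finite dimension the derived series becomes stationary; its stable term equals its
  own derived ideal and is nonzero without solvability.\<close>

lemma not_solvable_perfect_ideal:
  assumes fd: "fin_dim" and ns: "\<not> lie_solvable F L"
  obtains P where "lie_ideal F L P" "lie_derived F L P = P" "P \<noteq> {\<zero>\<^bsub>L\<^esub>}"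
proof -
  let ?T = "\<lambda>n. (lie_derived F L ^^ n) (carrier L)"
  have "\<exists>n. \<forall>m\<ge>n. ?T m = ?T n"
  proof (rule decreasing_subspaces_stabilise[OF fd])
    show "subspace F (?T n) L" for n using derived_series_ideal ideal_subspace by blast
    show "?T (Suc n) \<subseteq> ?T n" for n using derived_ideal(2)[OF derived_series_ideal[of n]] by simp
  qed
  then obtain n where "?T (Suc n) = ?T n" using le_SucI by blast
  moreover have "?T n \<noteq> {\<zero>\<^bsub>L\<^esub>}" using ns unfolding lie_solvable_def by blast
  ultimately show thesis using that[OF derived_series_ideal] by simp
qed

section \<open>Nil c-sections force solvability\<close>

text \<open>Hands on nilpotency modulo \<open>D\<close> as an equation for
  \<open>fitting_null\<close>, the form in which it is compared with nilpotency modulo another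
  ideal.\<close>

lemma Sec_nilE:
  assumes M: "lie_subalgebra F L M" and "Sec_nil F L M"
  obtains C D where "lie_ideal F L C" "lie_ideal F L D" "D \<subseteq> M" "carrier L = M <+>\<^bsub>L\<^esub> C"
    "\<And>x. x \<in> M \<inter> C \<Longrightarrow> fitting_null D x = carrier L"
proof -
  obtain C D where CD: "lie_ideal F L C" "lie_ideal F L D" "D \<subseteq> M" "carrier L = M <+>\<^bsub>L\<^esub> C"
    and nil: "nil_subalgebra F (lie_quotient L D) (quotient_image L D (M \<inter> C))"
    using assms(2) unfolding Sec_nil_def gives_c_section_def chief_factor_def by blast
  have "lie_subalgebra F L (M \<inter> C)"
    using M ideal_subalgebra[OF CD(1)] by (simp add: lie_subalgebra_def subspace_Int)
  hence "\<forall>x\<in>M \<inter> C. \<exists>n. \<forall>y\<in>carrier L. (lbr L x ^^ n) y \<in> D"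
    using nil nil_subalgebra_quotient_iff[OF CD(2)] by blast
  hence "fitting_null D x = carrier L" if "x \<in> M \<inter> C" for x
    using that unfolding fitting_null_def by blast
  thus thesis using CD that by blast
qed

lemma fitting_null_mono: "A \<subseteq> B \<Longrightarrow> fitting_null A x \<subseteq> fitting_null B x"
  by (auto simp: fitting_null_def)

text \<open>\<open>ad x\<close> and \<open>ad (x + a)\<close> induce the same map on
  \<open>L/A\<close>, so by induction their powers applied to \<open>y\<close> differ by an element
  of \<open>A\<close>.\<close>

lemma fitting_null_add:
  assumes A: "lie_ideal F L A" and x: "x \<in> carrier L" and a: "a \<in> A"
  shows "fitting_null A x \<subseteq> fitting_null A (x \<oplus>\<^bsub>L\<^esub> a)"
proof
  fix y assume "y \<in> fitting_null A x"
  then obtain n where y: "y \<in> carrier L" and n: "(lbr L x ^^ n) y \<in> A"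
    by (auto simp: fitting_null_def)
  have aL: "a \<in> carrier L" using a ideal_subset[OF A] by blast
  have "\<exists>b\<in>A. (lbr L (x \<oplus>\<^bsub>L\<^esub> a) ^^ k) y = (lbr L x ^^ k) y \<oplus>\<^bsub>L\<^esub> b" for k
  proof (induction k)
    case 0
    show ?case using y subspace_zero[OF ideal_subspace[OF A]] by (intro bexI[of _ "\<zero>\<^bsub>L\<^esub>"]) auto
  next
    case (Suc k)
    then obtain b where b: "b \<in> A" "(lbr L (x \<oplus>\<^bsub>L\<^esub> a) ^^ k) y = (lbr L x ^^ k) y \<oplus>\<^bsub>L\<^esub> b" by blast
    have bL: "b \<in> carrier L" using b ideal_subset[OF A] by blast
    let ?w = "(lbr L x ^^ k) y"
    have w: "?w \<in> carrier L" using ad_pow_closed[OF x y] .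
    have "lbr L x b \<oplus>\<^bsub>L\<^esub> (lbr L a ?w \<oplus>\<^bsub>L\<^esub> lbr L a b) \<in> A"
      using a b w x aL bL
      by (intro subspace_add[OF ideal_subspace[OF A]] ideal_lbr_left[OF A] ideal_lbr_right[OF A]) auto
    moreover have "(lbr L (x \<oplus>\<^bsub>L\<^esub> a) ^^ Suc k) y =
        lbr L x ?w \<oplus>\<^bsub>L\<^esub> (lbr L x b \<oplus>\<^bsub>L\<^esub> (lbr L a ?w \<oplus>\<^bsub>L\<^esub> lbr L a b))"
      using b(2) w x aL bL by (simp add: lbr_add_left lbr_add_right lbr_closed M.a_ac)
    ultimately show ?case by auto
  qed
  then obtain b where "b \<in> A" "(lbr L (x \<oplus>\<^bsub>L\<^esub> a) ^^ n) y = (lbr L x ^^ n) y \<oplus>\<^bsub>L\<^esub> b" by blast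
  hence "(lbr L (x \<oplus>\<^bsub>L\<^esub> a) ^^ n) y \<in> A" using n subspace_add[OF ideal_subspace[OF A]] by simp
  thus "y \<in> fitting_null A (x \<oplus>\<^bsub>L\<^esub> a)" using y by (auto simp: fitting_null_def)
qed

lemma solvable_if_Sec_nil:
  assumes fd: "fin_dim" and sec: "\<And>M. maximal_subalgebra F L M \<Longrightarrow> Sec_nil F L M"
  shows "lie_solvable F L"
proof (rule ccontr)
  assume "\<not> lie_solvable F L"
  then obtain P where P: "lie_ideal F L P" "lie_derived F L P = P" "P \<noteq> {\<zero>\<^bsub>L\<^esub>}"
    using not_solvable_perfect_ideal[OF fd] by blast
  let ?Q = "\<lambda>I. lie_ideal F L I \<and> \<not> P \<subseteq> I"
  have "\<not> P \<subseteq> {\<zero>\<^bsub>L\<^esub>}" using P(3) subspace_zero[OF ideal_subspace[OF P(1)]] by blast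
  then obtain A where "maximal A ?Q"
    using maximal_subspace_exists[OF fd, of ?Q "{\<zero>\<^bsub>L\<^esub>}"] ideal_zero ideal_subspace by blast
  hence A: "lie_ideal F L A" and PA: "\<not> P \<subseteq> A"
    and Amax: "\<And>I. \<lbrakk>lie_ideal F L I; A \<subseteq> I; I \<noteq> A\<rbrakk> \<Longrightarrow> P \<subseteq> I"
    unfolding maximal_def by blast+
  note As = ideal_subspace[OF A] and Ps = ideal_subspace[OF P(1)]
  define B where "B = A <+>\<^bsub>L\<^esub> P"
  have B: "lie_ideal F L B" unfolding B_def using A P(1) by (rule ideal_set_add)
  have AB: "A \<subseteq> B" and PB: "P \<subseteq> B"
    unfolding B_def using set_add_upper_left[OF As Ps] set_add_upper_right[OF As Ps] by auto
  have nilp: "fitting_null A x = carrier L" if x: "x \<in> B" for x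
  proof (rule ccontr)
    assume ne: "fitting_null A x \<noteq> carrier L"
    have xL: "x \<in> carrier L" using x ideal_subset[OF B] by blast
    obtain M where NM: "fitting_null A x \<subseteq> M" and M: "maximal_subalgebra F L M"
      using maximal_subalgebra_exists[OF fd fitting_null_subalgebra[OF A xL] ne] by blast
    note Msub = maximal_subalgebraD(1)[OF M]
    note Ms = subalgebra_subspace[OF Msub]
    have AM: "A \<subseteq> M" using fitting_null_upper[OF ideal_subset[OF A]] NM by blast
    \<comment> \<open>With \<open>P\<close> inside \<open>M\<close>, also \<open>B = A + P\<close>
      would be, and \<open>M\<close> would contain both summands of the Fitting decomposition of
      \<open>L\<close>.\<close>
    have PM: "\<not> P \<subseteq> M"
    proof
      assume "P \<subseteq> M"
      hence "B \<subseteq> M" unfolding B_def using set_add_least[OF Ms AM] by blast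
      hence "carrier L \<subseteq> M"
        using fitting_decomposition[OF fd A B x] set_add_least[OF Ms NM] by blast
      thus False using maximal_subalgebraD(2)[OF M] subspace_subset[OF Ms] by blast
    qed
    obtain C D where CD: "lie_ideal F L C" "lie_ideal F L D" "D \<subseteq> M" "carrier L = M <+>\<^bsub>L\<^esub> C"
      and nil: "\<And>x. x \<in> M \<inter> C \<Longrightarrow> fitting_null D x = carrier L"
      using Sec_nilE[OF Msub sec[OF M]] by blast
    note Cs = ideal_subspace[OF CD(1)] and Ds = ideal_subspace[OF CD(2)]
    \<comment> \<open>\<open>A + D\<close> is an ideal inside \<open>M\<close>, so it does not
      contain \<open>P\<close>; by the choice of \<open>A\<close> it cannot be larger than
      \<open>A\<close>.\<close>
    have "D \<subseteq> A"
    proof -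
      have "A <+>\<^bsub>L\<^esub> D \<subseteq> M" using set_add_least[OF Ms AM CD(3)] .
      hence "A <+>\<^bsub>L\<^esub> D = A"
        using Amax[OF ideal_set_add[OF A CD(2)] set_add_upper_left[OF As Ds]] PM by blast
      thus ?thesis using set_add_upper_right[OF As Ds] by simp
    qed
    have "\<not> C \<subseteq> M"
    proof
      assume "C \<subseteq> M"
      hence "carrier L \<subseteq> M" unfolding CD(4) using set_add_least[OF Ms subset_refl] by blast
      thus False using maximal_subalgebraD(2)[OF M] subspace_subset[OF Ms] by blast
    qed
    \<comment> \<open>\<open>M\<close> contains \<open>A\<close> but not \<open>C\<close>, so
      \<open>C + A\<close> is an ideal strictly above \<open>A\<close> and must contain
      \<open>P\<close>.\<close>
    hence "C <+>\<^bsub>L\<^esub> A \<noteq> A" using set_add_upper_left[OF Cs As] AM by blast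
    hence "P \<subseteq> C <+>\<^bsub>L\<^esub> A"
      using Amax[OF ideal_set_add[OF CD(1) A] set_add_upper_right[OF Cs As]] by blast
    hence "B \<subseteq> C <+>\<^bsub>L\<^esub> A"
      unfolding B_def
      using set_add_least[OF subspace_set_add[OF Cs As] set_add_upper_right[OF Cs As]] by blast
    hence "x \<in> C <+>\<^bsub>L\<^esub> A" using x by blast
    then obtain c a where ca: "c \<in> C" "a \<in> A" "x = c \<oplus>\<^bsub>L\<^esub> a" by (elim set_addE)
    have cL: "c \<in> carrier L" and aL: "a \<in> carrier L"
      using ca ideal_subset[OF CD(1)] ideal_subset[OF A] by auto
    \<comment> \<open>\<open>x\<close> lies in its own null component, hence in \<open>M\<close>;
      subtracting \<open>a\<close>, which lies in \<open>A\<close> and so in \<open>M\<close>, puts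
      \<open>c\<close> into the c-section.\<close>
    have "x \<in> M" using fitting_null_self[OF A xL] NM by blast
    hence "c \<in> M"
      using subspace_add_cancel_left[OF Ms, of a c] ca AM cL aL M.a_comm by auto
    \<comment> \<open>Nilpotency of \<open>c\<close> modulo \<open>D\<close> gives nilpotency modulo
      the larger ideal \<open>A\<close>, and this passes from \<open>c\<close> to
      \<open>x = c + a\<close>.\<close>
    hence "carrier L \<subseteq> fitting_null A c" using nil[of c] ca fitting_null_mono[OF \<open>D \<subseteq> A\<close>] by blast
    hence "carrier L \<subseteq> fitting_null A x" using fitting_null_add[OF A cL ca(2)] ca(3) by blast
    thus False using ne by (auto simp: fitting_null_def)
  qed
  have "A \<subset> B" using AB PB PA by blast
  then obtain H where H: "subspace F H L" "A \<subseteq> H" "H \<subset> B" "\<And>x y. \<lbrakk>x \<in> B; y \<in> B\<rbrakk> \<Longrightarrow> lbr L x y \<in> H"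
    using engel_not_perfect[OF fd A ideal_subalgebra[OF B] _ nilp] by blast
  \<comment> \<open>\<open>H\<close> contains the brackets of \<open>B\<close>, hence
    \<open>P = [P,P]\<close>; together with \<open>A\<close> this fills \<open>B\<close>, although
    \<open>H\<close> is proper in \<open>B\<close>.\<close>
  have "lie_derived F L P \<subseteq> H"
    unfolding derived_subset_iff[OF ideal_subset[OF P(1)] H(1)] using H(4) PB by blast
  hence "B \<subseteq> H" unfolding B_def P(2) using set_add_least[OF H(1,2)] by blast
  thus False using H(3) by blast
qed

section \<open>Solvability makes c-sections nil\<close>

text \<open>Iterating \<open>C = [C,C] + D\<close> puts \<open>C\<close> inside the sum of \<open>D\<close> and any term of the derived series.\<close>

lemma solvable_derived_add:
  assumes sol: "lie_solvable F L" and C: "lie_ideal F L C" and D: "lie_ideal F L D"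
    and CD: "C \<subseteq> lie_derived F L C <+>\<^bsub>L\<^esub> D"
  shows "C \<subseteq> D"
proof -
  let ?T = "\<lambda>n. (lie_derived F L ^^ n) (carrier L)"
  note Cs = ideal_subspace[OF C] and Ds = ideal_subspace[OF D]
  have "C \<subseteq> ?T n <+>\<^bsub>L\<^esub> D" for n
  proof (induction n)
    case 0
    show ?case using ideal_subset[OF C] set_add_upper_left[OF subspace_carrier Ds] by auto
  next
    case (Suc n)
    let ?I = "lie_derived F L (?T n)"
    note T = derived_series_ideal[of n]
    note I = derived_ideal(1)[OF T]
    note ID = ideal_set_add[OF I D]
    note up = set_add_upper_left[OF ideal_subspace[OF I] Ds]
      set_add_upper_right[OF ideal_subspace[OF I] Ds]
    have "lie_derived F L C \<subseteq> ?I <+>\<^bsub>L\<^esub> D"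
      unfolding derived_subset_iff[OF ideal_subset[OF C] ideal_subspace[OF ID]]
    proof (intro ballI)
      fix x y assume "x \<in> C" "y \<in> C"
      then obtain s d t e where st: "s \<in> ?T n" "t \<in> ?T n" and de: "d \<in> D" "e \<in> D"
        and xy: "x = s \<oplus>\<^bsub>L\<^esub> d" "y = t \<oplus>\<^bsub>L\<^esub> e"
        using Suc by (meson set_addE subsetD)
      have c: "s \<in> carrier L" "t \<in> carrier L" "d \<in> carrier L" "e \<in> carrier L"
        using st de ideal_subset[OF T] ideal_subset[OF D] by auto
      \<comment> \<open>Of the four brackets only \<open>[s,t]\<close> can lie outside
        \<open>D\<close>, and it belongs to the next term of the derived series.\<close>
      have "lbr L x y = lbr L s t \<oplus>\<^bsub>L\<^esub> (lbr L s e \<oplus>\<^bsub>L\<^esub> (lbr L d t \<oplus>\<^bsub>L\<^esub> lbr L d e))"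
        using c unfolding xy by (simp add: lbr_add_left lbr_add_right lbr_closed M.a_ac)
      moreover have "lbr L s t \<in> ?I" using lbr_derived[OF ideal_subset[OF T]] st by blast
      moreover have "lbr L s e \<oplus>\<^bsub>L\<^esub> (lbr L d t \<oplus>\<^bsub>L\<^esub> lbr L d e) \<in> D"
        using de c by (intro subspace_add[OF Ds] ideal_lbr_left[OF D] ideal_lbr_right[OF D]) auto
      ultimately show "lbr L x y \<in> ?I <+>\<^bsub>L\<^esub> D" by (auto simp: set_add_def')
    qed
    hence "lie_derived F L C <+>\<^bsub>L\<^esub> D \<subseteq> ?I <+>\<^bsub>L\<^esub> D"
      using set_add_least[OF ideal_subspace[OF ID] _ up(2)] by blast
    thus ?case using CD by simp
  qed
  moreover obtain n where "?T n = {\<zero>\<^bsub>L\<^esub>}" using sol unfolding lie_solvable_def by blast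
  ultimately have "C \<subseteq> {\<zero>\<^bsub>L\<^esub>} <+>\<^bsub>L\<^esub> D" by metis
  also have "\<dots> \<subseteq> D" using subspace_zero[OF Ds] by (intro set_add_least[OF Ds]) auto
  finally show ?thesis .
qed

lemma Sec_nil_if_solvable:
  assumes fd: "fin_dim" and sol: "lie_solvable F L" and M: "maximal_subalgebra F L M"
  shows "Sec_nil F L M"
proof -
  note Msub = maximal_subalgebraD(1)[OF M]
  note Ms = subalgebra_subspace[OF Msub]
  have proper: "\<not> carrier L \<subseteq> M" using maximal_subalgebraD(2)[OF M] subspace_subset[OF Ms] by blast
  \<comment> \<open>The chief factor is built from both ends: \<open>C\<close> is minimal among the
    ideals not inside \<open>M\<close>, then \<open>D\<close> is maximal among the ideals inside
    both \<open>M\<close> and \<open>C\<close>.\<close>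
  obtain C where "minimal C (\<lambda>I. lie_ideal F L I \<and> \<not> I \<subseteq> M)"
    using minimal_subspace_exists[OF fd, of "\<lambda>I. lie_ideal F L I \<and> \<not> I \<subseteq> M" "carrier L"]
      ideal_carrier ideal_subspace proper by blast
  hence C: "lie_ideal F L C" and CM: "\<not> C \<subseteq> M"
    and Cmin: "\<And>I. \<lbrakk>lie_ideal F L I; I \<subseteq> C; \<not> I \<subseteq> M\<rbrakk> \<Longrightarrow> I = C"
    unfolding minimal_def by blast+
  note Cs = ideal_subspace[OF C]
  have "{\<zero>\<^bsub>L\<^esub>} \<subseteq> M \<inter> C" using subspace_zero[OF Ms] subspace_zero[OF Cs] by blast
  then obtain D where "maximal D (\<lambda>I. lie_ideal F L I \<and> I \<subseteq> M \<inter> C)"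
    using maximal_subspace_exists[OF fd, of "\<lambda>I. lie_ideal F L I \<and> I \<subseteq> M \<inter> C" "{\<zero>\<^bsub>L\<^esub>}"]
      ideal_zero ideal_subspace by blast
  hence D: "lie_ideal F L D" and DM: "D \<subseteq> M" and DC: "D \<subseteq> C"
    and Dmax: "\<And>I. \<lbrakk>lie_ideal F L I; I \<subseteq> M \<inter> C; D \<subseteq> I\<rbrakk> \<Longrightarrow> I = D"
    unfolding maximal_def by blast+
  note Ds = ideal_subspace[OF D]
  \<comment> \<open>An ideal between \<open>D\<close> and \<open>C\<close> either lies in
    \<open>M\<close>, which makes it \<open>D\<close>, or does not, which makes it
    \<open>C\<close>.\<close>
  have between: "I = C" if "lie_ideal F L I" "D \<subset> I" "I \<subseteq> C" for I
    using that Cmin[of I] Dmax[of I] by blast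
  have chief: "chief_factor F L C D"
    using DC DM CM by (intro chief_factorI D C between) auto
  have "M \<subset> M <+>\<^bsub>L\<^esub> C" using set_add_upper_left[OF Ms Cs] set_add_upper_right[OF Ms Cs] CM by blast
  hence MC: "M <+>\<^bsub>L\<^esub> C = carrier L"
    by (intro maximal_subalgebraD(3)[OF M] subalgebra_set_add[OF Msub C])
  let ?C' = "lie_derived F L C"
  note C' = derived_ideal[OF C]
  note E = ideal_set_add[OF C'(1) D]
  note up = set_add_upper_left[OF ideal_subspace[OF C'(1)] Ds]
    set_add_upper_right[OF ideal_subspace[OF C'(1)] Ds]
  \<comment> \<open>If \<open>[C,C] + D\<close> were all of \<open>C\<close>, solvability would give
    \<open>C\<close> inside \<open>D\<close>, hence inside \<open>M\<close>. As \<open>C/D\<close>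
    is a chief factor, this ideal is then \<open>D\<close>, so \<open>C/D\<close> is
    abelian.\<close>
  have "?C' <+>\<^bsub>L\<^esub> D \<noteq> C" using solvable_derived_add[OF sol C D] CM DM by blast
  moreover have "?C' <+>\<^bsub>L\<^esub> D \<subseteq> C" using set_add_least[OF Cs C'(2) DC] .
  ultimately have "?C' <+>\<^bsub>L\<^esub> D = D" using between[OF E] up(2) by blast
  hence abelian: "?C' \<subseteq> D" using up(1) by simp
  have "(lbr L x ^^ 2) y \<in> D" if "x \<in> M \<inter> C" "y \<in> carrier L" for x y
    using that abelian lbr_derived[OF ideal_subset[OF C]] ideal_lbr_left[OF C]
    by (auto simp: numeral_2_eq_2)
  moreover have "lie_subalgebra F L (M \<inter> C)"
    using Msub ideal_subalgebra[OF C] by (simp add: lie_subalgebra_def subspace_Int)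
  ultimately have "nil_subalgebra F (lie_quotient L D) (quotient_image L D (M \<inter> C))"
    using nil_subalgebra_quotient_iff[OF D] by blast
  thus ?thesis unfolding Sec_nil_def gives_c_section_def using chief DM MC by metis
qed

end

theorem theorem2p6:
  fixes F :: "('a, 'n) ring_scheme" and L :: "('a, 'b, 'm) lie_scheme"
  assumes "lie_algebra F L" and "vectorspace.fin_dim F L"
  shows "(\<forall>M. maximal_subalgebra F L M \<longrightarrow> Sec_nil F L M) \<longleftrightarrow> lie_solvable F L"
proof -
  interpret lie_algebra F L by fact
  show ?thesis
    using solvable_if_Sec_nil[OF assms(2)] Sec_nil_if_solvable[OF assms(2)] by blast
qed

end
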